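(* Let $r\leq 1$ be an odd integer coprime with $5$. Let $p$ be an odd prime such that $p\equiv 2r\pmod{5}$ and $p\geq (5-r)/2$. Then $$ \sum_{k=0}^{p-1}(10k+r)\frac{(\frac{r}{5})_k^5}{(1)_k^5}\equiv\frac{12p^4}{25}\cdot\frac{\Gamma_p(\frac r5)^4}{\Gamma_p(\frac{2r}5)^2\Gamma_p(\frac12+\frac{3r}{10})\Gamma_p(\frac12-\frac r{10})^3}\sum_{k=0}^{(1-r)/2}\frac{(\frac{r-1}{2})_k(\frac r5)_k^3}{(1)_k(\frac{2r}5)_k^2(\frac12+\frac{3r}{10})_k}\pmod{p^5}. $$
   Context: For $n\in\{0,1,2,\ldots\}$, $(x)_n=x(x+1)\cdots(x+n-1)$ denotes the Pochhammer symbol (with $(x)_0=1$). $\Gamma_p$ denotes Morita's $p$-adic Gamma function. The congruence is understood in $\mathbb{Z}_p$, the ring of $p$-adic integers. *)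

theory Defs
  imports Complex_Main "HOL-Number_Theory.Cong" "Berlekamp_Zassenhaus.Finite_Field"
begin

section \<open>The ring of p-adic integers\<close>

text \<open>
  The prime \<open>p\<close> is carried by the type as \<open>CARD('p)\<close>, with \<open>'p\<close> of class \<^class>\<open>prime_card\<close>.
  The ring is the inverse limit of the rings \<open>\<int> / p\<^sup>n\<close>: an element is a sequence whose
  \<open>n\<close>-th entry is the reduced representative of its residue modulo \<open>p\<^sup>n\<close>.
\<close>

typedef (overloaded) ('p::prime_card) padic_int =
  "{x :: nat \<Rightarrow> int. \<forall>n. x n \<in> {0..<int CARD('p) ^ n} \<and> x (Suc n) mod int CARD('p) ^ n = x n}"
  morphisms padic_residue Abs_padic_int
  by (rule exI[of _ "\<lambda>_. 0"]) simp

setup_lifting type_definition_padic_int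

lemma mod_power_Suc_cancel: "a mod q ^ Suc n mod q ^ n = a mod q ^ n" for a q :: int
  by (simp add: mod_mod_cancel le_imp_power_dvd)

lemma padic_residue_mod [simp]:
  "padic_residue (x :: 'p::prime_card padic_int) n mod int CARD('p) ^ n = padic_residue x n"
  by transfer (auto intro: mod_pos_pos_trivial)

lemma padic_residue_mono:
  fixes x y :: "'p::prime_card padic_int"
  assumes "m \<le> n" "padic_residue x n = padic_residue y n"
  shows "padic_residue x m = padic_residue y m"
  using assms
proof (induction rule: dec_induct)
  case (step n)
  then have "padic_residue x (Suc n) mod int CARD('p) ^ n = padic_residue y (Suc n) mod int CARD('p) ^ n"
    by simp
  then have "padic_residue x n = padic_residue y n"
    by transfer simp
  with step.IH show ?case by simp
qed simp

instantiation padic_int :: (prime_card) comm_ring_1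
begin

lift_definition zero_padic_int :: "'a padic_int" is "\<lambda>_. 0" by simp

lift_definition one_padic_int :: "'a padic_int" is "\<lambda>n. 1 mod int CARD('a) ^ n"
  by (simp del: power_Suc add: mod_power_Suc_cancel)

lift_definition plus_padic_int :: "'a padic_int \<Rightarrow> 'a padic_int \<Rightarrow> 'a padic_int"
  is "\<lambda>x y n. (x n + y n) mod int CARD('a) ^ n"
  by (simp del: power_Suc add: mod_power_Suc_cancel) (metis mod_add_eq)

lift_definition minus_padic_int :: "'a padic_int \<Rightarrow> 'a padic_int \<Rightarrow> 'a padic_int"
  is "\<lambda>x y n. (x n - y n) mod int CARD('a) ^ n"
  by (simp del: power_Suc add: mod_power_Suc_cancel) (metis mod_diff_eq)

lift_definition uminus_padic_int :: "'a padic_int \<Rightarrow> 'a padic_int"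
  is "\<lambda>x n. (- x n) mod int CARD('a) ^ n"
  by (simp del: power_Suc add: mod_power_Suc_cancel) (metis mod_minus_eq)

lift_definition times_padic_int :: "'a padic_int \<Rightarrow> 'a padic_int \<Rightarrow> 'a padic_int"
  is "\<lambda>x y n. (x n * y n) mod int CARD('a) ^ n"
  by (simp del: power_Suc add: mod_power_Suc_cancel) (metis mod_mult_eq)

instance
proof
  fix a b c :: "'a padic_int"
  show "a * b * c = a * (b * c)"
    by transfer (simp add: fun_eq_iff mod_simps mult.assoc)
  show "a * b = b * a"
    by transfer (simp add: fun_eq_iff mult.commute)
  show "1 * a = a"
    by transfer (auto simp add: fun_eq_iff mod_simps intro: mod_pos_pos_trivial)
  show "(a + b) * c = a * c + b * c"
    by transfer (simp add: fun_eq_iff mod_simps distrib_right)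
  show "a + b + c = a + (b + c)"
    by transfer (simp add: fun_eq_iff mod_simps add.assoc)
  show "a + b = b + a"
    by transfer (simp add: fun_eq_iff add.commute)
  show "0 + a = a"
    by transfer (auto simp add: fun_eq_iff intro: mod_pos_pos_trivial)
  show "- a + a = 0"
    by transfer (simp add: fun_eq_iff mod_simps)
  show "a - b = a + - b"
    by transfer (simp add: fun_eq_iff mod_simps)
  show "(0 :: 'a padic_int) \<noteq> 1"
  proof (transfer, rule notI)
    assume "(\<lambda>_. 0) = (\<lambda>n. 1 mod int CARD('a) ^ n)"
    from fun_cong[OF this, of 1] have "1 mod int CARD('a) = 0" by simp
    moreover have "CARD('a) > 1"
      using prime_card[where 'a='a] by (rule prime_gt_1_nat)
    ultimately show False by simp
  qed
qed

end

text \<open>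
  Division inside the ring, by units only: non-units have the junk inverse \<open>0\<close>.
\<close>

instantiation padic_int :: (prime_card) inverse
begin

definition inverse_padic_int :: "'a padic_int \<Rightarrow> 'a padic_int" where
  "inverse_padic_int x = (if x dvd 1 then THE y. x * y = 1 else 0)"

definition divide_padic_int :: "'a padic_int \<Rightarrow> 'a padic_int \<Rightarrow> 'a padic_int" where
  "divide_padic_int x y = x * inverse y"

instance ..

end

lemma padic_int_right_inverse:
  fixes x :: "'p::prime_card padic_int"
  assumes "x dvd 1"
  shows "x * inverse x = 1"
proof -
  from assms obtain y where y: "x * y = 1" by (metis dvdE)
  have "z = y" if "x * z = 1" for z
    using that y by (metis mult.assoc mult.commute mult_1)
  with y have "(THE y. x * y = 1) = y" by blast
  with y assms show ?thesis by (simp add: inverse_padic_int_def)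
qed

text \<open>The \<open>p\<close>-adic topology: residue classes modulo the powers of \<open>p\<close> form a base.\<close>

instantiation padic_int :: (prime_card) t2_space
begin

definition open_padic_int :: "'a padic_int set \<Rightarrow> bool" where
  "open S \<longleftrightarrow> (\<forall>x\<in>S. \<exists>n. \<forall>y. padic_residue y n = padic_residue x n \<longrightarrow> y \<in> S)"

instance
proof
  show "open (UNIV :: 'a padic_int set)"
    by (simp add: open_padic_int_def)
next
  fix S T :: "'a padic_int set"
  assume S: "open S" and T: "open T"
  show "open (S \<inter> T)"
    unfolding open_padic_int_def
  proof
    fix x assume "x \<in> S \<inter> T"
    then obtain m n where
      m: "\<And>y. padic_residue y m = padic_residue x m \<Longrightarrow> y \<in> S" and
      n: "\<And>y. padic_residue y n = padic_residue x n \<Longrightarrow> y \<in> T"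
      using S T unfolding open_padic_int_def by blast
    have "y \<in> S \<inter> T" if "padic_residue y (max m n) = padic_residue x (max m n)" for y
      using m n padic_residue_mono[OF _ that] by simp
    then show "\<exists>n. \<forall>y. padic_residue y n = padic_residue x n \<longrightarrow> y \<in> S \<inter> T" by blast
  qed
next
  fix K :: "'a padic_int set set"
  assume K: "\<forall>S\<in>K. open S"
  show "open (\<Union>K)"
    unfolding open_padic_int_def
  proof
    fix x assume "x \<in> \<Union>K"
    then obtain S where S: "S \<in> K" "x \<in> S" by blast
    then obtain n where "\<forall>y. padic_residue y n = padic_residue x n \<longrightarrow> y \<in> S"
      using K unfolding open_padic_int_def by blast
    then show "\<exists>n. \<forall>y. padic_residue y n = padic_residue x n \<longrightarrow> y \<in> \<Union>K"
      using S(1) by blast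
  qed
next
  fix x y :: "'a padic_int"
  assume "x \<noteq> y"
  then obtain n where n: "padic_residue x n \<noteq> padic_residue y n"
    by (metis ext padic_residue_inject)
  let ?B = "\<lambda>z. {u. padic_residue u n = padic_residue z n}"
  have "open (?B z)" for z :: "'a padic_int"
    unfolding open_padic_int_def by (intro ballI exI[of _ n]) simp
  moreover have "x \<in> ?B x" "y \<in> ?B y" "?B x \<inter> ?B y = {}"
    using n by auto
  ultimately show "\<exists>U V. open U \<and> open V \<and> x \<in> U \<and> y \<in> V \<and> U \<inter> V = {}"
    by blast
qed

end

section \<open>Morita's p-adic Gamma function\<close>

definition padic_Gamma_nat :: "nat \<Rightarrow> 'p::prime_card padic_int" where
  "padic_Gamma_nat n = (-1) ^ n * of_nat (\<Prod>k | 0 < k \<and> k < n \<and> \<not> CARD('p) dvd k. k)"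

text \<open>
  The value at \<open>x\<close> is the limit of the values at natural numbers \<open>n\<close> tending \<open>p\<close>-adically to \<open>x\<close>.
\<close>

definition padic_Gamma :: "'p::prime_card padic_int \<Rightarrow> 'p padic_int" where
  "padic_Gamma x = Lim (filtercomap of_nat (nhds x)) padic_Gamma_nat"

end

theory Submission
  imports Defs
begin

text \<open>
  Put \<open>a = r / 5 = t - n\<close> with \<open>t = 3 p / 5\<close> and \<open>n = (3 p - r) / 5 < p\<close>. Modulo \<open>p\<^sup>5\<close> the sum stops at
  \<open>k = n\<close>, because later terms contain \<open>t\<^sup>5\<close>. Deform it to
  \<open>S(x, y) = \<Sum>\<^sub>k w\<^sub>k \<psi>\<^sub>k(x) \<psi>\<^sub>k(y)\<close>, where \<open>w\<^sub>k = (a + 2k) (a)\<^sub>k / k!\<close> and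
  \<open>\<psi>\<^sub>k(x) = (a + x)\<^sub>k (a - x)\<^sub>k / ((1 - x)\<^sub>k (1 + x)\<^sub>k)\<close>. Then
  \<open>S(0, 0) = 2 S(t, 0) - S(t, t) + \<Sum>\<^sub>k w\<^sub>k (\<psi>\<^sub>k(0) - \<psi>\<^sub>k(t))\<^sup>2\<close>. In the last sum the squares are divisible by
  \<open>t\<^sup>4\<close>, and modulo \<open>p\<close> the cofactors are antisymmetric under \<open>k \<mapsto> n - k\<close>, so it vanishes modulo \<open>p\<^sup>5\<close>.
  Since \<open>a - t = -n\<close>, the series \<open>S(t, y)\<close> terminates, and a transformation of very-well-poised series
  into balanced ones (both sides satisfy the same recursion in \<open>n\<close>) writes it as an explicit product,
  divisible by \<open>p\<^sup>4\<close>, times a sum of length \<open>(1 - r) / 2\<close>. It remains to evaluate the product and the sum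
  modulo \<open>p\<close>; by Wilson's theorem the product becomes the quotient of Gamma values.
\<close>

section \<open>A transformation of terminating well-poised series\<close>

text \<open>Since \<psi> is even in its argument, S(t, t) agrees with S(0, 0) only to second order
  in t. Completing the square in \<psi>(0) - \<psi>(t) leaves 2 S(t, 0) - S(t, t), whose two sums
  both have t in a slot and hence terminate at n, with an error of fourth order; the antisymmetry
  supplies the fifth power of p. The constant 12 / 25 comes from the four factors divisible by p,
  namely t = 3 p / 5, p - 2 t - y, p - 2 t + y and (p - 3 t) / 2 = -2 p / 5. Their product is -6 p^4
  / 625 for y = 0 and 48 p^4 / 625 for y = t, so the combination gives -12 p^4 / 125. Passing from a
  + 2k to 10k + r multiplies by 5, and the minus sign is absorbed by the Gamma quotient. The
  transformation needs a field in which no shifted lower parameter vanishes, so all identities live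
  in the rationals; only the final congruence is carried over to the p-adic integers.\<close>

lemma pochhammer_nonzero:
  fixes q :: "'a::field_char_0"
  assumes "\<And>j::nat. q + of_nat j \<noteq> 0"
  shows "pochhammer q k \<noteq> 0"
  using assms by (metis add.left_inverse pochhammer_eq_0_iff)

text \<open>
  The second divided difference of \<open>f(z) = (y1 + z) (y2 + z) (y3 + z)\<close> at the nodes \<open>e + m\<close>, \<open>- \<epsilon>\<close> and \<open>j\<close>
  is the sum of the nodes plus \<open>y1 + y2 + y3\<close>; this one identity drives the recursion in \<open>n\<close> of the balanced series.
\<close>

lemma cubic_divided_difference:
  fixes e \<epsilon> j m :: "'a::field"
  assumes "\<epsilon> + j \<noteq> 0"
  shows "(y1 + (e + m)) * (y2 + (e + m)) * (y3 + (e + m))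
      + (e + m - j) * ((y1 - \<epsilon>) * (y2 - \<epsilon>) * (y3 - \<epsilon>)) / (\<epsilon> + j)
    = (e + m + \<epsilon>) * ((y1 + y2 + y3 + e - \<epsilon> + m + j) * (e + m - j)
      + (y1 + j) * (y2 + j) * (y3 + j) / (\<epsilon> + j))"
proof -
  define w where "w = \<epsilon> + j"
  then have j: "j = w - \<epsilon>" and "w \<noteq> 0" using assms by simp_all
  have "(y1 + (e + m)) * (y2 + (e + m)) * (y3 + (e + m)) * w
      + (e + m - j) * ((y1 - \<epsilon>) * (y2 - \<epsilon>) * (y3 - \<epsilon>))
    = (e + m + \<epsilon>) * ((y1 + y2 + y3 + e - \<epsilon> + m + j) * (e + m - j) * w
      + (y1 + j) * (y2 + j) * (y3 + j))"
    unfolding j by (simp add: algebra_simps)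
  then show ?thesis
    using \<open>w \<noteq> 0\<close> unfolding w_def[symmetric] by (simp add: field_simps)
qed

text \<open>Pascal's rule multiplied by s + m; the two leftover terms cancel by absorption, (j+1)
  C(m, j+1) = (m-j) C(m, j).\<close>

lemma binomial_shift_identity:
  fixes s :: "'a::field_char_0"
  assumes "j \<le> m"
  shows "of_nat (m choose Suc j) * (s + of_nat m + of_nat (Suc j)) + of_nat (m choose j) * (s + of_nat j)
    = of_nat (Suc m choose Suc j) * (s + of_nat m)"
proof -
  have "(m choose Suc j) * Suc j = (m choose j) * (m - j)"
    using binomial_absorb_comp[of m j] binomial_absorption[of j "m - 1"]
    by (metis Suc_times_binomial_eq binomial_absorption mult.commute times_binomial_minus1_eq zero_less_Suc diff_Suc_1)
  then have "of_nat (m choose Suc j) * (1 + of_nat j) = (of_nat (m choose j) * (of_nat m - of_nat j) :: 'a)"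
    using assms by (metis of_nat_Suc of_nat_diff of_nat_mult)
  then show ?thesis by (simp add: algebra_simps)
qed

text \<open>By \<open>cubic_divided_difference\<close> the term at j splits into a part
  \<open>?U\<close> that keeps its index and a part \<open>?V\<close> that belongs to j + 1. After
  the shift, \<open>binomial_shift_identity\<close> merges the two into one term of the sum of
  length m + 1.\<close>

lemma balanced_sum_contiguous:
  fixes e \<epsilon> y1 y2 y3 :: "'a::field_char_0"
  defines "P \<equiv> \<lambda>j. pochhammer y1 j * pochhammer y2 j * pochhammer y3 j"
    and "s \<equiv> y1 + y2 + y3 + e - \<epsilon>"
  assumes \<epsilon>: "\<And>j::nat. \<epsilon> + of_nat j \<noteq> 0"
  shows "(e + of_nat m + \<epsilon>) * (\<Sum>j\<le>Suc m. of_nat (Suc m choose j) * pochhammer e (Suc m - j)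
        * pochhammer (s + of_nat j) (Suc m - j) * P j / pochhammer \<epsilon> j)
    = (\<Sum>j\<le>m. of_nat (m choose j) * pochhammer e (m - j) * pochhammer (s + of_nat j) (m - j) * P j / pochhammer \<epsilon> j
        * ((y1 + (e + of_nat m)) * (y2 + (e + of_nat m)) * (y3 + (e + of_nat m))
          + (e + of_nat m - of_nat j) * ((y1 - \<epsilon>) * (y2 - \<epsilon>) * (y3 - \<epsilon>)) / (\<epsilon> + of_nat j)))"
    (is "?c * (\<Sum>j\<le>_. ?X j) = (\<Sum>j\<le>m. ?Y j * ?F j)")
proof -
  have eps: "pochhammer \<epsilon> j \<noteq> 0" for j
    using \<epsilon> by (rule pochhammer_nonzero)
  let ?U = "\<lambda>j. of_nat (m choose j) * pochhammer e (Suc m - j) * pochhammer (s + of_nat j) (m - j)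
    * (s + of_nat m + of_nat j) * P j / pochhammer \<epsilon> j"
  let ?V = "\<lambda>j. of_nat (m choose j) * pochhammer e (m - j) * pochhammer (s + of_nat j) (m - j)
    * P (Suc j) / pochhammer \<epsilon> (Suc j)"
  have "?Y j * ?F j = ?c * (?U j + ?V j)" if "j \<le> m" for j
  proof -
    have "?F j = ?c * ((s + of_nat m + of_nat j) * (e + of_nat m - of_nat j)
        + (y1 + of_nat j) * (y2 + of_nat j) * (y3 + of_nat j) / (\<epsilon> + of_nat j))"
      unfolding s_def by (rule cubic_divided_difference[OF \<epsilon>])
    moreover have "pochhammer e (Suc m - j) = pochhammer e (m - j) * (e + of_nat m - of_nat j)"
      using that by (simp add: Suc_diff_le pochhammer_Suc of_nat_diff algebra_simps)
    moreover have "P (Suc j) = P j * ((y1 + of_nat j) * (y2 + of_nat j) * (y3 + of_nat j))"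
      by (simp add: P_def pochhammer_Suc algebra_simps)
    moreover have "pochhammer \<epsilon> (Suc j) = pochhammer \<epsilon> j * (\<epsilon> + of_nat j)"
      by (simp add: pochhammer_Suc)
    moreover have "X * E * S * p / q * (C * (A * B + f / w)) = C * (X * (E * B) * S * A * p / q + X * E * S * (p * f) / (q * w))"
      if "q \<noteq> 0" "w \<noteq> 0" for X E S p q C A B f w :: 'a
      using that by (simp add: field_simps)
    ultimately show ?thesis
      using eps[of j] \<epsilon>[of j] by (simp only:)
  qed
  then have "(\<Sum>j\<le>m. ?Y j * ?F j) = (\<Sum>j\<le>m. ?c * (?U j + ?V j))"
    by (intro sum.cong) simp_all
  also have "\<dots> = ?c * ((\<Sum>j\<le>m. ?U j) + (\<Sum>j\<le>m. ?V j))"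
    by (simp only: sum.distrib sum_distrib_left[symmetric])
  also have "(\<Sum>j\<le>m. ?U j) = ?U 0 + (\<Sum>j\<le>m. ?U (Suc j))"
  proof -
    \<comment> \<open>The added term is zero: its binomial coefficient is m choose m + 1.\<close>
    have "(\<Sum>j\<le>m. ?U j) = (\<Sum>j\<le>Suc m. ?U j)" by simp
    then show ?thesis by (simp only: sum.atMost_Suc_shift)
  qed
  also have "?U 0 + (\<Sum>j\<le>m. ?U (Suc j)) + (\<Sum>j\<le>m. ?V j) = ?U 0 + (\<Sum>j\<le>m. ?U (Suc j) + ?V j)"
    by (simp add: sum.distrib)
  also have "(\<Sum>j\<le>m. ?U (Suc j) + ?V j) = (\<Sum>j\<le>m. ?X (Suc j))"
  proof (rule sum.cong)
    fix j assume "j \<in> {..m}"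
    then have j: "j \<le> m" by simp
    show "?U (Suc j) + ?V j = ?X (Suc j)"
    proof (cases "j = m")
      \<comment> \<open>Here \<open>m - Suc j\<close> would be truncated; \<open>?U (Suc m)\<close>
        vanishes and \<open>?V m\<close> alone is the top term.\<close>
      case True
      then show ?thesis by simp
    next
      case False
      with j obtain i where i: "m = Suc (j + i)" using less_imp_Suc_add by (metis le_neq_implies_less)
      have "pochhammer (s + of_nat j) (m - j) = (s + of_nat j) * pochhammer (s + of_nat (Suc j)) (m - Suc j)"
        using i by (simp add: pochhammer_rec algebra_simps)
      moreover have "pochhammer (s + of_nat (Suc j)) (Suc m - Suc j)
          = pochhammer (s + of_nat (Suc j)) (m - Suc j) * (s + of_nat m)"
        using i by (simp add: pochhammer_Suc algebra_simps)
      moreover have "?X (Suc j) = pochhammer e (m - j) * P (Suc j) / pochhammer \<epsilon> (Suc j)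
          * pochhammer (s + of_nat (Suc j)) (m - Suc j) * (of_nat (Suc m choose Suc j) * (s + of_nat m))"
        unfolding calculation(2) by simp
      moreover have "?U (Suc j) + ?V j = pochhammer e (m - j) * P (Suc j) / pochhammer \<epsilon> (Suc j)
          * pochhammer (s + of_nat (Suc j)) (m - Suc j) *
          (of_nat (m choose Suc j) * (s + of_nat m + of_nat (Suc j)) + of_nat (m choose j) * (s + of_nat j))"
        unfolding calculation(1) by (simp add: algebra_simps add_divide_distrib)
      ultimately show ?thesis using binomial_shift_identity[OF j, of s] by simp
    qed
  qed simp
  also have "?U 0 + (\<Sum>j\<le>m. ?X (Suc j)) = (\<Sum>j\<le>Suc m. ?X j)"
    by (simp add: sum.atMost_Suc_shift pochhammer_Suc del: sum.atMost_Suc)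
  finally show ?thesis ..
qed

text \<open>As a + 2k = a (1 + a/2)_k / (a/2)_k, these are a times the terms of the very-well-poised
  7F6 at 1 with parameters a, 1 + a/2, b, c, d, e, -n.\<close>

definition well_poised_term :: "'a::field_char_0 \<Rightarrow> 'a \<Rightarrow> 'a \<Rightarrow> 'a \<Rightarrow> 'a \<Rightarrow> nat \<Rightarrow> nat \<Rightarrow> 'a" where
  "well_poised_term a b c d e n k = (a + 2 * of_nat k) *
    (pochhammer a k * pochhammer b k * pochhammer c k * pochhammer d k * pochhammer e k * pochhammer (- of_nat n) k) /
    (fact k * pochhammer (1 + a - b) k * pochhammer (1 + a - c) k * pochhammer (1 + a - d) k
      * pochhammer (1 + a - e) k * pochhammer (1 + a + of_nat n) k)"

text \<open>With s = 2 + 2a - b - c - d - e, this is (e)_n (s)_n times the term of the balanced 4F3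
  with upper parameters -n, 1+a-b-e, 1+a-c-e, 1+a-d-e and lower ones 1+a-e, 1-e-n, s. The
  multiplication keeps 1-e-n and s out of the denominator.\<close>

definition balanced_term :: "'a::field_char_0 \<Rightarrow> 'a \<Rightarrow> 'a \<Rightarrow> 'a \<Rightarrow> 'a \<Rightarrow> nat \<Rightarrow> nat \<Rightarrow> 'a" where
  "balanced_term a b c d e n j = of_nat (n choose j) * pochhammer e (n - j)
    * pochhammer (2 + 2 * a - b - c - d - e + of_nat j) (n - j)
    * (pochhammer (1 + a - b - e) j * pochhammer (1 + a - c - e) j * pochhammer (1 + a - d - e) j)
    / pochhammer (1 + a - e) j"

text \<open>This quotient is the only part of a well-poised term that depends on n. Its difference
  has the same shape again, with a raised by 2, since 3 + a + m = 1 + (a + 2) + m.\<close>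

lemma terminating_factor_difference:
  fixes a :: "'a::field_char_0"
  assumes "\<And>j::nat. a + of_nat j \<noteq> 0"
  shows "pochhammer (- of_nat (Suc m)) (Suc i) / pochhammer (1 + a + of_nat (Suc m)) (Suc i)
      - pochhammer (- of_nat m) (Suc i) / pochhammer (1 + a + of_nat m) (Suc i)
    = - of_nat (Suc i) * (a + of_nat (Suc i)) * pochhammer (- of_nat m) i
      / ((a + of_nat (Suc m)) * (a + of_nat (Suc (Suc m))) * pochhammer (3 + a + of_nat m) i)"
proof -
  define z where "z = a + of_nat (Suc m)"
  have nz: "z + of_nat j \<noteq> 0" for j
    using assms[of "Suc m + j"] by (simp add: z_def algebra_simps)
  have e1: "1 + a + of_nat (Suc m) = z + 1" "1 + a + of_nat m = z" "3 + a + of_nat m = z + 1 + 1"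
      "a + of_nat (Suc m) = z" "a + of_nat (Suc (Suc m)) = z + 1"
    by (simp_all add: z_def algebra_simps)
  have p1: "pochhammer (- of_nat (Suc m) :: 'a) (Suc i) = - of_nat (Suc m) * pochhammer (- of_nat m) i"
    by (simp add: pochhammer_rec)
  have p2: "pochhammer (- of_nat m :: 'a) (Suc i) = pochhammer (- of_nat m) i * (of_nat i - of_nat m)"
    by (simp add: pochhammer_Suc)
  have p3: "pochhammer (z + 1) (Suc i) = (z + 1) * pochhammer (z + 1 + 1) i"
    by (rule pochhammer_rec)
  have "pochhammer z (Suc i) * (z + of_nat (Suc i)) = z * pochhammer (z + 1) (Suc i)"
    by (metis pochhammer_Suc pochhammer_rec)
  then have p4: "pochhammer z (Suc i) = z * (z + 1) * pochhammer (z + 1 + 1) i / (z + of_nat (Suc i))"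
    using nz[of "Suc i"] p3 by (simp add: field_simps)
  have nz': "pochhammer (z + 1 + 1) i \<noteq> 0"
    by (rule pochhammer_nonzero) (use nz[of "2 + _"] in \<open>simp add: algebra_simps\<close>)
  have nzs: "z \<noteq> 0" "z + 1 \<noteq> 0" "z + of_nat (Suc i) \<noteq> 0"
    using nz[of 0] nz[of 1] nz[of "Suc i"] by simp_all
  have a: "a = z - of_nat (Suc m)" by (simp add: z_def)
  show ?thesis
    unfolding e1 p1 p2 p3 p4 unfolding a using nz' nzs
    by (simp add: divide_simps) (simp add: algebra_simps)
qed

text \<open>\<open>W\<close> collects the factors free of n. The difference in n contributes i + 1,
  which cancels against the factorial, and a + i + 1, which completes (a)_(i+1) to a (a+1) (a+2)_i.
  What remains is a term with a raised by 2 and b, c, d, e by 1.\<close>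

lemma well_poised_term_recurrence:
  fixes a b c d e :: "'a::field_char_0"
  assumes a: "\<And>j::nat. a + of_nat j \<noteq> 0"
  shows "well_poised_term a b c d e (Suc m) (Suc i) = well_poised_term a b c d e m (Suc i)
    - a * (a + 1) * b * c * d * e / ((1 + a - b) * (1 + a - c) * (1 + a - d) * (1 + a - e)
        * (a + of_nat (Suc m)) * (a + of_nat (Suc (Suc m))))
      * well_poised_term (a + 2) (b + 1) (c + 1) (d + 1) (e + 1) m i"
proof -
  define W where "W = (a + 2 * of_nat (Suc i)) *
    (pochhammer a (Suc i) * pochhammer b (Suc i) * pochhammer c (Suc i) * pochhammer d (Suc i) * pochhammer e (Suc i)) /
    (fact (Suc i) * pochhammer (1 + a - b) (Suc i) * pochhammer (1 + a - c) (Suc i) * pochhammer (1 + a - d) (Suc i)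
      * pochhammer (1 + a - e) (Suc i))"
  define Z where "Z = (a + of_nat (Suc m)) * (a + of_nat (Suc (Suc m)))"
  have shift: "1 + (a + 2) - (x + 1) = 1 + a - x + 1" for x by simp
  have W: "W * (- of_nat (Suc i) * (a + of_nat (Suc i))) =
      - a * (a + 1) * b * c * d * e / ((1 + a - b) * (1 + a - c) * (1 + a - d) * (1 + a - e)) *
      ((a + 2 + 2 * of_nat i) * (pochhammer (a + 2) i * pochhammer (b + 1) i * pochhammer (c + 1) i
        * pochhammer (d + 1) i * pochhammer (e + 1) i) /
      (fact i * pochhammer (1 + a - b + 1) i * pochhammer (1 + a - c + 1) i * pochhammer (1 + a - d + 1) i
      * pochhammer (1 + a - e + 1) i))"
  proof -
    have "pochhammer a (Suc i) * (a + of_nat (Suc i)) = a * (a + 1) * pochhammer (a + 2) i"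
      using pochhammer_rec[of "a + 1" i] pochhammer_rec[of a "Suc i"] pochhammer_Suc[of a "Suc i"]
      by (simp add: add.assoc)
    moreover have "fact (Suc i) = of_nat (Suc i) * (fact i :: 'a)" by simp
    moreover have "a + 2 * of_nat (Suc i) = a + 2 + 2 * of_nat i" by simp
    moreover have "of_nat (Suc i) \<noteq> (0 :: 'a)" by (rule of_nat_neq_0)
    moreover have "A * (p * (b * pb) * (c * pc) * (d * pd) * (e * pe))
          / ((k * F) * (q1 * Q1) * (q2 * Q2) * (q3 * Q3) * (q4 * Q4)) * (- k * ak)
        = - a * a1 * b * c * d * e / (q1 * q2 * q3 * q4) * (A * (p2 * pb * pc * pd * pe) / (F * Q1 * Q2 * Q3 * Q4))"
      if p: "p * ak = a * a1 * p2" and "k \<noteq> 0"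
      for A p pb pc pd pe k F q1 Q1 q2 Q2 q3 Q3 q4 Q4 ak a1 p2 :: 'a
    proof -
      have "A * (p * (b * pb) * (c * pc) * (d * pd) * (e * pe))
          / ((k * F) * (q1 * Q1) * (q2 * Q2) * (q3 * Q3) * (q4 * Q4)) * (- k * ak)
        = k * (- (A * (p * ak) * b * pb * c * pc * d * pd * e * pe)) / (k * (F * q1 * Q1 * q2 * Q2 * q3 * Q3 * q4 * Q4))"
        by (simp add: mult_ac)
      then show ?thesis unfolding p using that(2) by (simp add: mult_ac)
    qed
    ultimately show ?thesis
      unfolding W_def pochhammer_rec[of b] pochhammer_rec[of c] pochhammer_rec[of d] pochhammer_rec[of e]
        pochhammer_rec[of "1 + a - _"] by (simp only:)
  qed
  have "well_poised_term a b c d e (Suc m) (Suc i) - well_poised_term a b c d e m (Suc i)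
    = W * (pochhammer (- of_nat (Suc m)) (Suc i) / pochhammer (1 + a + of_nat (Suc m)) (Suc i)
      - pochhammer (- of_nat m) (Suc i) / pochhammer (1 + a + of_nat m) (Suc i))"
    unfolding well_poised_term_def W_def right_diff_distrib by (simp only: times_divide_times_eq mult.assoc)
  also have "\<dots> = W * (- of_nat (Suc i) * (a + of_nat (Suc i))) * (pochhammer (- of_nat m) i
      / (Z * pochhammer (3 + a + of_nat m) i))"
    unfolding terminating_factor_difference[OF a] Z_def by (simp only: times_divide_eq_right mult.assoc)
  also have "\<dots> = - (a * (a + 1) * b * c * d * e / ((1 + a - b) * (1 + a - c) * (1 + a - d) * (1 + a - e) * Z)
      * well_poised_term (a + 2) (b + 1) (c + 1) (d + 1) (e + 1) m i)"
  proof -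
    have "3 + a + of_nat m = 1 + (a + 2) + of_nat m" by simp
    then show ?thesis unfolding W well_poised_term_def shift
      by (simp only: times_divide_times_eq mult_minus_left mult_minus_right minus_divide_left mult_ac)
  qed
  finally have "well_poised_term a b c d e (Suc m) (Suc i) = well_poised_term a b c d e m (Suc i) -
      a * (a + 1) * b * c * d * e / ((1 + a - b) * (1 + a - c) * (1 + a - d) * (1 + a - e) * Z)
      * well_poised_term (a + 2) (b + 1) (c + 1) (d + 1) (e + 1) m i"
    by (metis diff_add_cancel add.commute uminus_add_conv_diff)
  then show ?thesis unfolding Z_def mult.assoc .
qed

text \<open>In \<open>balanced_sum_contiguous\<close> the nodes are such that y1 - \<epsilon>, y2 -
  \<epsilon>, y3 - \<epsilon> are -b, -c, -d and e + m + \<epsilon> is a + m + 1. The value at the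
  first node then extends the Pochhammer denominators, the value at the second gives the sum with
  raised parameters; s is unchanged by the raising.\<close>

lemma balanced_sum_recurrence:
  fixes a b c d e :: "'a::field_char_0"
  assumes a: "\<And>j::nat. a + of_nat j \<noteq> 0" and e: "\<And>j::nat. 1 + a - e + of_nat j \<noteq> 0"
    and b: "\<And>j::nat. 1 + a - b + of_nat j \<noteq> 0" and c: "\<And>j::nat. 1 + a - c + of_nat j \<noteq> 0"
    and d: "\<And>j::nat. 1 + a - d + of_nat j \<noteq> 0"
  defines "R \<equiv> \<lambda>a b c d e n. pochhammer a (Suc n) /
    (pochhammer (1 + a - b) n * pochhammer (1 + a - c) n * pochhammer (1 + a - d) n)
    * (\<Sum>j\<le>n. balanced_term a b c d e n j)"
  shows "R a b c d e (Suc m) = R a b c d e m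
    - a * (a + 1) * b * c * d * e / ((1 + a - b) * (1 + a - c) * (1 + a - d) * (1 + a - e)
        * (a + of_nat (Suc m)) * (a + of_nat (Suc (Suc m))))
      * R (a + 2) (b + 1) (c + 1) (d + 1) (e + 1) m"
proof -
  define \<epsilon> where "\<epsilon> = 1 + a - e"
  define y1 where "y1 = 1 + a - b - e"
  define y2 where "y2 = 1 + a - c - e"
  define y3 where "y3 = 1 + a - d - e"
  define s where "s = y1 + y2 + y3 + e - \<epsilon>"
  define P where "P j = pochhammer y1 j * pochhammer y2 j * pochhammer y3 j" for j
  have s: "2 + 2 * a - b - c - d - e = s" by (simp add: s_def \<epsilon>_def y1_def y2_def y3_def)
  define Y where "Y j = of_nat (m choose j) * pochhammer e (m - j) * pochhammer (s + of_nat j) (m - j)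
    * P j / pochhammer \<epsilon> j" for j
  have eps: "\<epsilon> + of_nat j \<noteq> 0" for j using e by (simp add: \<epsilon>_def)
  have T: "balanced_term a b c d e n j = of_nat (n choose j) * pochhammer e (n - j)
        * pochhammer (s + of_nat j) (n - j) * P j / pochhammer \<epsilon> j" for n j
    unfolding balanced_term_def s \<epsilon>_def P_def y1_def y2_def y3_def by simp
  have T': "e * balanced_term (a + 2) (b + 1) (c + 1) (d + 1) (e + 1) m j / \<epsilon>
    = Y j * ((e + of_nat m - of_nat j) / (\<epsilon> + of_nat j))" if "j \<le> m" for j
  proof -
    have 1: "2 + 2 * (a + 2) - (b + 1) - (c + 1) - (d + 1) - (e + 1) = s"
      "1 + (a + 2) - (b + 1) - (e + 1) = y1" "1 + (a + 2) - (c + 1) - (e + 1) = y2"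
      "1 + (a + 2) - (d + 1) - (e + 1) = y3" "1 + (a + 2) - (e + 1) = \<epsilon> + 1"
      by (simp_all add: s[symmetric] \<epsilon>_def y1_def y2_def y3_def)
    have 2: "e * pochhammer (e + 1) (m - j) = pochhammer e (m - j) * (e + of_nat m - of_nat j)"
      using that by (metis pochhammer_rec pochhammer_Suc of_nat_diff add_diff_eq)
    have 3: "\<epsilon> * pochhammer (\<epsilon> + 1) j = pochhammer \<epsilon> j * (\<epsilon> + of_nat j)"
      by (metis pochhammer_rec pochhammer_Suc)
    have "e * balanced_term (a + 2) (b + 1) (c + 1) (d + 1) (e + 1) m j / \<epsilon> =
      of_nat (m choose j) * (e * pochhammer (e + 1) (m - j)) * pochhammer (s + of_nat j) (m - j) * P j
      / (\<epsilon> * pochhammer (\<epsilon> + 1) j)"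
      unfolding balanced_term_def 1 P_def by (simp add: mult_ac)
    then show ?thesis unfolding 2 3 Y_def by (simp add: mult_ac)
  qed
  define A where "A = (\<Sum>j\<le>Suc m. balanced_term a b c d e (Suc m) j)"
  define B where "B = (\<Sum>j\<le>m. balanced_term a b c d e m j)"
  define C where "C = (\<Sum>j\<le>m. balanced_term (a + 2) (b + 1) (c + 1) (d + 1) (e + 1) m j)"
  define F where "F = (1 + a - b + of_nat m) * (1 + a - c + of_nat m) * (1 + a - d + of_nat m)"
  have "(a + of_nat (Suc m)) * A = (\<Sum>j\<le>m. Y j * (F - (e + of_nat m - of_nat j) * (b * c * d) / (\<epsilon> + of_nat j)))"
  proof -
    have "y1 - \<epsilon> = - b" "y2 - \<epsilon> = - c" "y3 - \<epsilon> = - d" "e + of_nat m + \<epsilon> = a + of_nat (Suc m)"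
      "y1 + (e + of_nat m) = 1 + a - b + of_nat m" "y2 + (e + of_nat m) = 1 + a - c + of_nat m"
      "y3 + (e + of_nat m) = 1 + a - d + of_nat m"
      by (simp_all add: \<epsilon>_def y1_def y2_def y3_def)
    note balanced_sum_contiguous[OF eps, of e m y1 y2 y3, unfolded this]
    then show ?thesis
      unfolding A_def T Y_def F_def P_def s_def by (simp del: sum.atMost_Suc of_nat_Suc)
  qed
  also have "\<dots> = F * (\<Sum>j\<le>m. Y j) - b * c * d * (\<Sum>j\<le>m. Y j * ((e + of_nat m - of_nat j) / (\<epsilon> + of_nat j)))"
    unfolding sum_distrib_left sum_subtractf[symmetric] by (intro sum.cong) (simp_all add: algebra_simps)
  also have "(\<Sum>j\<le>m. Y j * ((e + of_nat m - of_nat j) / (\<epsilon> + of_nat j))) = e / \<epsilon> * C"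
    unfolding C_def sum_distrib_left using T' by (intro sum.cong) simp_all
  also have "(\<Sum>j\<le>m. Y j) = B" by (simp add: B_def T Y_def)
  finally have main: "(a + of_nat (Suc m)) * A = F * B - b * c * d * (e / \<epsilon> * C)" .
  define Q where "Q n = pochhammer (1 + a - b) n * pochhammer (1 + a - c) n * pochhammer (1 + a - d) n" for n
  define q where "q = (1 + a - b) * (1 + a - c) * (1 + a - d)"
  define Q' where "Q' = pochhammer (1 + a - b + 1) m * pochhammer (1 + a - c + 1) m * pochhammer (1 + a - d + 1) m"
  have Q: "Q n \<noteq> 0" for n
    using pochhammer_nonzero[OF b] pochhammer_nonzero[OF c] pochhammer_nonzero[OF d] by (simp add: Q_def)
  have q: "q \<noteq> 0" using b[of 0] c[of 0] d[of 0] by (simp add: q_def)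
  have QS: "Q (Suc m) = Q m * F" by (simp add: Q_def F_def pochhammer_Suc mult_ac)
  have QS': "Q (Suc m) = q * Q'" by (simp add: Q_def q_def Q'_def pochhammer_rec mult_ac)
  have F: "F \<noteq> 0" using Q[of "Suc m"] QS by auto
  have Q': "Q' \<noteq> 0" using Q[of "Suc m"] QS' by auto
  define x where "x = a + of_nat (Suc m)"
  define x' where "x' = a + of_nat (Suc (Suc m))"
  define p where "p = pochhammer a (Suc m)"
  have x: "x \<noteq> 0" "x' \<noteq> 0" using a by (simp_all add: x_def x'_def del: of_nat_Suc)
  have p1: "pochhammer a (Suc (Suc m)) = p * x"
    by (simp add: p_def x_def pochhammer_Suc)
  have p2: "a * (a + 1) * pochhammer (a + 2) (Suc m) = p * x * x'"
  proof -
    have "a * (a + 1) * pochhammer (a + 2) (Suc m) = pochhammer a (Suc (Suc (Suc m)))"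
      unfolding pochhammer_rec[of a] pochhammer_rec[of "a + 1"] by (simp add: mult.assoc add.assoc)
    then show ?thesis by (simp add: p1[unfolded x_def] pochhammer_Suc[of _ "Suc (Suc m)"] x_def x'_def)
  qed
  have shift: "1 + (a + 2) - (z + 1) = 1 + a - z + 1" for z by simp
  have "R a b c d e (Suc m) = p * (x * A) / Q (Suc m)"
    unfolding R_def p1 A_def Q_def by simp
  also have "\<dots> = p * B * F / Q (Suc m) - p * (b * c * d) * (e / \<epsilon> * C) / Q (Suc m)"
    unfolding main[folded x_def] by (simp add: algebra_simps diff_divide_distrib)
  also have "p * B * F / Q (Suc m) = R a b c d e m"
    unfolding R_def B_def[symmetric] Q_def[symmetric] QS p_def using F by simp
  also have "p * (b * c * d) * (e / \<epsilon> * C) / Q (Suc m) =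
      b * c * d * e / (q * \<epsilon> * x * x') * (p * x * x' / Q' * C)"
    unfolding QS' using x q Q' by (simp add: mult_ac)
  also have "\<dots> = a * (a + 1) * b * c * d * e / (q * \<epsilon> * x * x') * (pochhammer (a + 2) (Suc m) / Q' * C)"
    unfolding p2[symmetric] by (simp add: mult_ac)
  also have "pochhammer (a + 2) (Suc m) / Q' * C = R (a + 2) (b + 1) (c + 1) (d + 1) (e + 1) m"
    unfolding R_def shift Q'_def C_def by simp
  finally show ?thesis unfolding q_def \<epsilon>_def x_def x'_def by simp
qed

text \<open>A form of Whipple's transformation. The recursion raises the parameters, hence the
  induction leaves all of them free.\<close>

theorem well_poised_balanced_transformation:
  fixes a b c d e :: "'a::field_char_0"
  assumes "\<And>j::nat. a + of_nat j \<noteq> 0" and "\<And>j::nat. 1 + a - b + of_nat j \<noteq> 0"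
    and "\<And>j::nat. 1 + a - c + of_nat j \<noteq> 0" and "\<And>j::nat. 1 + a - d + of_nat j \<noteq> 0"
    and "\<And>j::nat. 1 + a - e + of_nat j \<noteq> 0"
  shows "(\<Sum>k\<le>n. well_poised_term a b c d e n k) = pochhammer a (Suc n) /
    (pochhammer (1 + a - b) n * pochhammer (1 + a - c) n * pochhammer (1 + a - d) n)
    * (\<Sum>j\<le>n. balanced_term a b c d e n j)"
  using assms
proof (induction n arbitrary: a b c d e)
  case 0
  then show ?case by (simp add: well_poised_term_def balanced_term_def)
next
  case (Suc m)
  have shift: "1 + (a + 2) - (z + 1) = 1 + a - z + 1" for z by simp
  have IH: "(\<Sum>k\<le>m. well_poised_term (a + 2) (b + 1) (c + 1) (d + 1) (e + 1) m k) = pochhammer (a + 2) (Suc m) /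
    (pochhammer (1 + (a + 2) - (b + 1)) m * pochhammer (1 + (a + 2) - (c + 1)) m * pochhammer (1 + (a + 2) - (d + 1)) m)
    * (\<Sum>j\<le>m. balanced_term (a + 2) (b + 1) (c + 1) (d + 1) (e + 1) m j)"
  proof (rule Suc.IH)
    show "a + 2 + of_nat j \<noteq> 0" for j
      using Suc.prems(1)[of "2 + j"] by (simp add: algebra_simps)
  qed (use Suc.prems(2)[of "Suc j" for j] Suc.prems(3)[of "Suc j" for j] Suc.prems(4)[of "Suc j" for j]
      Suc.prems(5)[of "Suc j" for j] in \<open>simp_all only: shift of_nat_Suc add.assoc not_False_eq_True\<close>)
  let ?T = "well_poised_term a b c d e" and ?S = "well_poised_term (a + 2) (b + 1) (c + 1) (d + 1) (e + 1) m"
  let ?c = "a * (a + 1) * b * c * d * e / ((1 + a - b) * (1 + a - c) * (1 + a - d) * (1 + a - e)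
        * (a + of_nat (Suc m)) * (a + of_nat (Suc (Suc m))))"
  have "(\<Sum>k\<le>Suc m. ?T (Suc m) k) = ?T (Suc m) 0 + (\<Sum>i\<le>m. ?T (Suc m) (Suc i))"
    by (rule sum.atMost_Suc_shift)
  also have "\<dots> = ?T m 0 + (\<Sum>i\<le>m. ?T m (Suc i)) - ?c * (\<Sum>i\<le>m. ?S i)"
    unfolding well_poised_term_recurrence[OF Suc.prems(1)] sum_subtractf sum_distrib_left[symmetric]
    by (simp add: well_poised_term_def)
  also have "?T m 0 + (\<Sum>i\<le>m. ?T m (Suc i)) = (\<Sum>k\<le>Suc m. ?T m k)"
    by (rule sum.atMost_Suc_shift[symmetric])
  \<comment> \<open>The term at m + 1 contains (-m)_(m+1) = 0.\<close>
  also have "\<dots> = (\<Sum>k\<le>m. ?T m k)"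
    by (simp add: well_poised_term_def pochhammer_of_nat_eq_0_iff)
  finally show ?case
    unfolding Suc.IH[OF Suc.prems] IH
    unfolding balanced_sum_recurrence[OF Suc.prems(1) Suc.prems(5) Suc.prems(2-4)] by simp
qed

section \<open>Rational numbers with denominators prime to p\<close>

text \<open>\<open>Zloc\<close> is the localization of the integers at p, inside a field where the
  hypergeometric identities make sense; in the p-adic type a quotient by a non-unit is junk.\<close>

locale rat_localization =
  fixes p :: nat
  assumes prime_p: "prime p"
begin

definition Zloc :: "rat set" where
  "Zloc = {of_int u / of_int v | u v. \<not> int p dvd v}"

definition Zunits :: "rat set" where
  "Zunits = {of_int u / of_int v | u v. \<not> int p dvd u \<and> \<not> int p dvd v}"

definition cong_mod :: "nat \<Rightarrow> rat \<Rightarrow> rat \<Rightarrow> bool" where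
  "cong_mod m x y \<longleftrightarrow> (\<exists>z\<in>Zloc. x - y = of_nat p ^ m * z)"

lemma prime_int_p: "prime (int p)"
  using prime_p by simp

lemma not_dvd_mult: "\<not> int p dvd u \<Longrightarrow> \<not> int p dvd v \<Longrightarrow> \<not> int p dvd u * v"
  using prime_int_p by (simp add: prime_dvd_mult_iff)

lemma Zloc_I: "\<not> int p dvd v \<Longrightarrow> x = of_int u / of_int v \<Longrightarrow> x \<in> Zloc"
  unfolding Zloc_def by blast

lemma Zunit_I: "\<not> int p dvd u \<Longrightarrow> \<not> int p dvd v \<Longrightarrow> x = of_int u / of_int v \<Longrightarrow> x \<in> Zunits"
  unfolding Zunits_def by blast

lemma Zloc_E:
  assumes "x \<in> Zloc"
  obtains u v where "\<not> int p dvd v" "v \<noteq> 0" "x = of_int u / of_int v"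
  using assms unfolding Zloc_def by auto

lemma Zunit_E:
  assumes "x \<in> Zunits"
  obtains u v where "\<not> int p dvd u" "\<not> int p dvd v" "u \<noteq> 0" "v \<noteq> 0" "x = of_int u / of_int v"
  using assms unfolding Zunits_def by auto

lemma Zunit_Zloc: "x \<in> Zunits \<Longrightarrow> x \<in> Zloc"
  unfolding Zloc_def Zunits_def by blast

lemma Zunit_nonzero: "x \<in> Zunits \<Longrightarrow> x \<noteq> 0"
  by (erule Zunit_E) simp

lemma not_dvd_one: "\<not> int p dvd 1"
  using prime_int_p by (metis not_prime_unit)

lemma Zloc_of_int [simp]: "of_int u \<in> Zloc"
  by (rule Zloc_I[of 1 _ u]) (use not_dvd_one in simp_all)

lemma Zloc_of_nat [simp]: "of_nat u \<in> Zloc"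
  using Zloc_of_int[of "int u"] by simp

lemma Zloc_numeral [simp]: "numeral u \<in> Zloc" "1 \<in> Zloc" "0 \<in> Zloc"
  using Zloc_of_int[of "numeral u"] Zloc_of_int[of 1] Zloc_of_int[of 0] by simp_all

lemma Zunit_of_int: "\<not> int p dvd u \<Longrightarrow> of_int u \<in> Zunits"
  by (rule Zunit_I[of u 1]) (use not_dvd_one in simp_all)

lemma Zunit_of_nat: "\<not> p dvd u \<Longrightarrow> of_nat u \<in> Zunits"
  using Zunit_of_int[of "int u"] by simp

lemma Zunit_one [simp]: "1 \<in> Zunits"
  using Zunit_of_int[of 1] not_dvd_one by simp

lemma Zloc_uminus [simp]:
  assumes "x \<in> Zloc"
  shows "- x \<in> Zloc"
proof -
  from assms obtain u v where "\<not> int p dvd v" "x = of_int u / of_int v" by (rule Zloc_E)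
  then show ?thesis by (intro Zloc_I[of v _ "- u"]) simp_all
qed

lemma Zloc_add [simp]:
  assumes "x \<in> Zloc" "y \<in> Zloc"
  shows "x + y \<in> Zloc"
  using assms
proof (elim Zloc_E)
  fix u v u' v' assume *: "\<not> int p dvd v" "\<not> int p dvd v'" "v \<noteq> 0" "v' \<noteq> 0"
    and "x = of_int u / of_int v" "y = of_int u' / of_int v'"
  then have "x + y = of_int (u * v' + u' * v) / of_int (v * v')" by (simp add: field_simps)
  then show ?thesis by (rule Zloc_I[rotated]) (use * not_dvd_mult in blast)
qed

lemma Zloc_diff [simp]: "x \<in> Zloc \<Longrightarrow> y \<in> Zloc \<Longrightarrow> x - y \<in> Zloc"
  using Zloc_add[of x "- y"] by simp

lemma Zloc_mult [simp]:
  assumes "x \<in> Zloc" "y \<in> Zloc"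
  shows "x * y \<in> Zloc"
  using assms
proof (elim Zloc_E)
  fix u v u' v' assume *: "\<not> int p dvd v" "\<not> int p dvd v'"
    and "x = of_int u / of_int v" "y = of_int u' / of_int v'"
  then have "x * y = of_int (u * u') / of_int (v * v')" by simp
  then show ?thesis by (rule Zloc_I[rotated]) (use * not_dvd_mult in blast)
qed

lemma Zloc_power [simp]: "x \<in> Zloc \<Longrightarrow> x ^ k \<in> Zloc"
  by (induction k) simp_all

lemma Zloc_sum [simp]: "(\<And>i. i \<in> A \<Longrightarrow> f i \<in> Zloc) \<Longrightarrow> sum f A \<in> Zloc"
  by (induction A rule: infinite_finite_induct) simp_all

lemma Zloc_prod [simp]: "(\<And>i. i \<in> A \<Longrightarrow> f i \<in> Zloc) \<Longrightarrow> prod f A \<in> Zloc"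
  by (induction A rule: infinite_finite_induct) simp_all

lemma Zloc_pochhammer [simp]: "x \<in> Zloc \<Longrightarrow> pochhammer x k \<in> Zloc"
  by (simp add: pochhammer_prod)

lemma Zunit_mult [simp]:
  assumes "x \<in> Zunits" "y \<in> Zunits"
  shows "x * y \<in> Zunits"
  using assms
proof (elim Zunit_E)
  fix u v u' v' assume *: "\<not> int p dvd v" "\<not> int p dvd v'" "\<not> int p dvd u" "\<not> int p dvd u'"
    and "x = of_int u / of_int v" "y = of_int u' / of_int v'"
  then have "x * y = of_int (u * u') / of_int (v * v')" by simp
  then show ?thesis by (rule Zunit_I[rotated 2]) (use * not_dvd_mult in blast)+
qed

lemma Zunit_inverse [simp]: "x \<in> Zunits \<Longrightarrow> inverse x \<in> Zunits"
  by (erule Zunit_E) (rule Zunit_I, auto)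

lemma Zunit_divide [simp]: "x \<in> Zunits \<Longrightarrow> y \<in> Zunits \<Longrightarrow> x / y \<in> Zunits"
  by (simp add: divide_inverse)

lemma Zloc_divide [simp]: "x \<in> Zloc \<Longrightarrow> y \<in> Zunits \<Longrightarrow> x / y \<in> Zloc"
  by (simp add: divide_inverse Zunit_Zloc)

lemma Zunit_power [simp]: "x \<in> Zunits \<Longrightarrow> x ^ k \<in> Zunits"
  by (induction k) simp_all

lemma Zunit_prod [simp]: "(\<And>i. i \<in> A \<Longrightarrow> f i \<in> Zunits) \<Longrightarrow> prod f A \<in> Zunits"
  by (induction A rule: infinite_finite_induct) simp_all

lemma cong_refl [simp]: "cong_mod m x x"
  unfolding cong_mod_def by (rule bexI[of _ 0]) simp_all

lemma cong_sym: "cong_mod m x y \<Longrightarrow> cong_mod m y x"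
  unfolding cong_mod_def by (metis Zloc_uminus minus_diff_eq mult_minus_right)

lemma cong_add:
  assumes "cong_mod m x y" "cong_mod m x' y'"
  shows "cong_mod m (x + x') (y + y')"
proof -
  from assms obtain z z' where "z \<in> Zloc" "z' \<in> Zloc" "x - y = of_nat p ^ m * z" "x' - y' = of_nat p ^ m * z'"
    unfolding cong_mod_def by blast
  moreover have "x + x' - (y + y') = (x - y) + (x' - y')" by simp
  ultimately show ?thesis
    unfolding cong_mod_def by (intro bexI[of _ "z + z'"]) (simp_all add: distrib_left)
qed

lemma cong_trans [trans]: "cong_mod m x y \<Longrightarrow> cong_mod m y z \<Longrightarrow> cong_mod m x z"
  using cong_add[of m x y y z] unfolding cong_mod_def by simp

lemma cong_uminus: "cong_mod m x y \<Longrightarrow> cong_mod m (- x) (- y)"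
  unfolding cong_mod_def by (metis Zloc_uminus minus_diff_minus mult_minus_right)

lemma cong_diff: "cong_mod m x y \<Longrightarrow> cong_mod m x' y' \<Longrightarrow> cong_mod m (x - x') (y - y')"
  using cong_add[of m x y "- x'" "- y'"] cong_uminus by simp

lemma cong_scale: "cong_mod m x y \<Longrightarrow> c \<in> Zloc \<Longrightarrow> cong_mod m (c * x) (c * y)"
  unfolding cong_mod_def by (metis Zloc_mult mult.left_commute right_diff_distrib)

lemma cong_mult:
  assumes "cong_mod m x y" "cong_mod m x' y'" "x \<in> Zloc" "y' \<in> Zloc"
  shows "cong_mod m (x * x') (y * y')"
  using cong_trans[OF cong_scale[OF assms(2,3)] cong_scale[OF assms(1,4), unfolded mult.commute[of y']]]
  by (simp add: mult.commute)

lemma cong_sum: "(\<And>i. i \<in> A \<Longrightarrow> cong_mod m (f i) (g i)) \<Longrightarrow> cong_mod m (sum f A) (sum g A)"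
  by (induction A rule: infinite_finite_induct) (simp_all add: cong_add)

lemma cong_prod:
  assumes "\<And>i. i \<in> A \<Longrightarrow> cong_mod m (f i) (g i)" "\<And>i. i \<in> A \<Longrightarrow> f i \<in> Zloc" "\<And>i. i \<in> A \<Longrightarrow> g i \<in> Zloc"
  shows "cong_mod m (prod f A) (prod g A)"
  using assms by (induction A rule: infinite_finite_induct) (simp_all add: cong_mult)

lemma cong_power:
  assumes "cong_mod m x y" "x \<in> Zloc" "y \<in> Zloc"
  shows "cong_mod m (x ^ k) (y ^ k)"
  using assms by (induction k) (simp_all add: cong_mult)

lemma cong_pochhammer:
  assumes "cong_mod m x y" "x \<in> Zloc" "y \<in> Zloc"
  shows "cong_mod m (pochhammer x k) (pochhammer y k)"
  using assms unfolding pochhammer_prod by (intro cong_prod cong_add) simp_all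

lemma cong_divide:
  assumes "cong_mod m x y" "cong_mod m x' y'" "y \<in> Zloc" "x' \<in> Zunits" "y' \<in> Zunits"
  shows "cong_mod m (x / x') (y / y')"
proof -
  have nz: "x' \<noteq> 0" "y' \<noteq> 0" using assms Zunit_nonzero by auto
  have "cong_mod m (x * y') (y * x')"
    using cong_mult[OF assms(1) cong_refl[of m y']] cong_scale[OF cong_sym[OF assms(2)] assms(3)]
      cong_trans assms(4,5) Zunit_Zloc cong_sym[OF assms(1)] cong_scale[OF assms(1), of y']
    by (metis mult.commute)
  then have "cong_mod m (1 / (x' * y') * (x * y')) (1 / (x' * y') * (y * x'))"
    using assms(4,5) by (intro cong_scale) (simp_all add: Zunit_Zloc)
  then show ?thesis using nz by (simp add: field_simps)
qed

text \<open>The numerator changes only by a multiple of p. Unit conditions on parameters deformed by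
  t or y thereby reduce to the undeformed ones.\<close>

lemma cong_unit:
  assumes "cong_mod 1 x y" "x \<in> Zunits" "y \<in> Zloc"
  shows "y \<in> Zunits"
proof -
  from assms(1) obtain z where z: "z \<in> Zloc" "x - y = of_nat p * z" unfolding cong_mod_def by auto
  obtain u v where u: "\<not> int p dvd u" "\<not> int p dvd v" "u \<noteq> 0" "v \<noteq> 0" "x = of_int u / of_int v"
    using assms(2) by (rule Zunit_E)
  obtain u' v' where u': "\<not> int p dvd v'" "v' \<noteq> 0" "z = of_int u' / of_int v'"
    using z(1) by (rule Zloc_E)
  have "y = x - of_nat p * z" using z(2) by simp
  also have "\<dots> = of_int (u * v' - int p * (u' * v)) / of_int (v * v')"
    unfolding u(5) u'(3) using u(4) u'(2) by (simp add: field_simps)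
  finally show ?thesis
    by (rule Zunit_I[rotated 2]) (use u u' not_dvd_mult in \<open>auto simp: dvd_diff_left_iff\<close>)
qed

text \<open>An explicit factor p^4 turns a congruence modulo p into one modulo p^5, so the cofactors
  are only ever needed modulo p.\<close>

lemma cong_power_scale:
  assumes "cong_mod m x y"
  shows "cong_mod (k + m) (of_nat p ^ k * x) (of_nat p ^ k * y)"
proof -
  from assms(1) obtain z where "z \<in> Zloc" "x - y = of_nat p ^ m * z" unfolding cong_mod_def by auto
  then show ?thesis unfolding cong_mod_def
    by (intro bexI[of _ z]) (simp_all add: power_add right_diff_distrib[symmetric] mult.assoc)
qed

lemma cong_zero_iff: "cong_mod m x 0 \<longleftrightarrow> (\<exists>z\<in>Zloc. x = of_nat p ^ m * z)"
  unfolding cong_mod_def by simp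

end

section \<open>From rational numbers to p-adic integers\<close>

lemma padic_residue_mod_power:
  fixes x :: "'p::prime_card padic_int"
  assumes "m \<le> n"
  shows "padic_residue x n mod int CARD('p) ^ m = padic_residue x m"
  using assms
proof (induction rule: dec_induct)
  case base
  show ?case by simp
next
  case (step n)
  have "padic_residue x (Suc n) mod int CARD('p) ^ n = padic_residue x n" by transfer simp
  with step.IH step.hyps show ?case
    by (metis le_imp_power_dvd mod_mod_cancel)
qed

lemma padic_residue_range:
  fixes x :: "'p::prime_card padic_int"
  shows "0 \<le> padic_residue x n" "padic_residue x n < int CARD('p) ^ n"
  using padic_residue[of x] by auto

lemma card_prime_gt_1: "CARD('p::prime_card) > 1"
  using prime_card[where 'a='p] by (rule prime_gt_1_nat)

lemma padic_residue_of_nat: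
  "padic_residue (of_nat k :: 'p::prime_card padic_int) n = int k mod int CARD('p) ^ n"
  by (induction k) (simp_all add: zero_padic_int.rep_eq plus_padic_int.rep_eq one_padic_int.rep_eq mod_simps add.commute)

lemma padic_residue_of_int:
  "padic_residue (of_int k :: 'p::prime_card padic_int) n = k mod int CARD('p) ^ n"
proof (cases k rule: int_cases)
  case (nonneg m)
  then show ?thesis by (simp add: padic_residue_of_nat)
next
  case (neg m)
  then have "of_int k = (- of_nat (Suc m) :: 'p padic_int)" "k = - int (Suc m)" by simp_all
  then show ?thesis by (simp only: uminus_padic_int.rep_eq padic_residue_of_nat mod_minus_eq)
qed

lemma padic_int_eqI:
  fixes x y :: "'p::prime_card padic_int"
  assumes "\<And>n. padic_residue x n = padic_residue y n"
  shows "x = y"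
  using assms by (metis ext padic_residue_inject)

lemma padic_of_residues:
  assumes "\<And>n. x n \<in> {0..<int CARD('p::prime_card) ^ n}" "\<And>n. x (Suc n) mod int CARD('p) ^ n = x n"
  obtains y :: "'p::prime_card padic_int" where "\<And>n. padic_residue y n = x n"
proof
  show "padic_residue (Abs_padic_int x :: 'p padic_int) n = x n" for n
    using assms by (subst Abs_padic_int_inverse) auto
qed

text \<open>All residues are prime to p, hence invertible modulo p^n, and the inverses fit together
  into a p-adic integer.\<close>

lemma padic_unitI:
  fixes x :: "'p::prime_card padic_int"
  assumes "padic_residue x 1 \<noteq> 0"
  shows "x dvd 1"
proof -
  let ?p = "int CARD('p)"
  have prime: "prime ?p" using prime_card[where 'a='p] by simp
  have "\<exists>y. y \<in> {0..<?p ^ n} \<and> [padic_residue x n * y = 1] (mod ?p ^ n)" for n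
  proof -
    have "coprime (padic_residue x n) (?p ^ n)"
    proof (cases n)
      case (Suc m)
      then have "\<not> ?p dvd padic_residue x n"
        using padic_residue_mod_power[of 1 n x] assms by (auto simp: dvd_eq_mod_eq_0)
      then show ?thesis using prime_imp_coprime[OF prime] by (simp add: coprime_commute)
    qed simp
    then obtain y where "[padic_residue x n * y = 1] (mod ?p ^ n)"
      using cong_solve_coprime_int by blast
    then have "[padic_residue x n * (y mod ?p ^ n) = 1] (mod ?p ^ n)"
      by (simp add: cong_def mod_simps)
    then show ?thesis
      by (intro exI[of _ "y mod ?p ^ n"]) (use card_prime_gt_1[where 'p='p] in auto)
  qed
  then obtain y where y: "\<And>n. y n \<in> {0..<?p ^ n}" "\<And>n. [padic_residue x n * y n = 1] (mod ?p ^ n)"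
    by metis
  \<comment> \<open>Compatibility is the uniqueness of inverses modulo p^n.\<close>
  have "y (Suc n) mod ?p ^ n = y n" for n
  proof -
    have "[padic_residue x (Suc n) * y (Suc n) = 1] (mod ?p ^ n)"
      using y(2)[of "Suc n"] by (rule cong_dvd_modulus) (simp add: le_imp_power_dvd)
    moreover have "[padic_residue x (Suc n) = padic_residue x n] (mod ?p ^ n)"
      using padic_residue_mod_power[of n "Suc n" x] by (simp add: cong_def)
    ultimately have "[padic_residue x n * y (Suc n) = 1] (mod ?p ^ n)"
      by (meson cong_scalar_right cong_sym cong_trans)
    then have "[y (Suc n) * (padic_residue x n * y n) = y n] (mod ?p ^ n)"
      using cong_scalar_right[of "padic_residue x n * y (Suc n)" 1 "?p ^ n" "y n"] by (simp add: mult_ac)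
    moreover have "[y (Suc n) * (padic_residue x n * y n) = y (Suc n) * 1] (mod ?p ^ n)"
      using y(2)[of n] by (rule cong_scalar_left)
    ultimately have "[y (Suc n) = y n] (mod ?p ^ n)"
      by (metis cong_sym cong_trans mult.right_neutral)
    then show ?thesis using y(1)[of n] by (simp add: cong_def)
  qed
  with y(1) obtain z :: "'p padic_int" where z: "\<And>n. padic_residue z n = y n"
    using padic_of_residues[of y] by blast
  have "x * z = 1"
    using y(2) by (intro padic_int_eqI) (simp add: times_padic_int.rep_eq one_padic_int.rep_eq z cong_def)
  then show ?thesis by (metis dvd_triv_left)
qed

text \<open>Dividing by p costs one digit: the n-th residue of the quotient is the residue of x at n
  + 1, divided by p.\<close>

lemma padic_dvd_prime:
  fixes x :: "'p::prime_card padic_int"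
  assumes "padic_residue x 1 = 0"
  shows "of_nat CARD('p) dvd x"
proof -
  let ?p = "int CARD('p)"
  have p: "?p > 1" using card_prime_gt_1[where 'p='p] by simp
  define y where "y n = padic_residue x (Suc n) div ?p" for n
  have y: "padic_residue x (Suc n) = ?p * y n" for n
    using padic_residue_mod_power[of 1 "Suc n" x] assms by (auto simp: y_def)
  have "y n \<in> {0..<?p ^ n}" for n
    using padic_residue_range[of x "Suc n"] p unfolding y by (simp add: zero_le_mult_iff)
  moreover have "y (Suc n) mod ?p ^ n = y n" for n
  proof -
    have "?p * (y (Suc n) mod ?p ^ n) = (?p * y (Suc n)) mod (?p * ?p ^ n)"
      by (rule mult_mod_right)
    also have "\<dots> = ?p * y n"
      using padic_residue_mod_power[of "Suc n" "Suc (Suc n)" x] unfolding y by simp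
    finally show ?thesis using p by simp
  qed
  ultimately obtain z :: "'p padic_int" where z: "\<And>n. padic_residue z n = y n"
    using padic_of_residues[of y] by blast
  have "x = of_nat CARD('p) * z"
  proof (rule padic_int_eqI)
    fix n
    have "padic_residue (of_nat CARD('p) * z) n = (?p * y n) mod ?p ^ n"
      by (simp add: times_padic_int.rep_eq padic_residue_of_nat z mod_simps)
    also have "\<dots> = padic_residue x n"
      unfolding y[symmetric] by (rule padic_residue_mod_power) simp
    finally show "padic_residue x n = padic_residue (of_nat CARD('p) * z) n" ..
  qed
  then show ?thesis by simp
qed

lemma padic_unit_of_int:
  assumes "\<not> int CARD('p::prime_card) dvd v"
  shows "(of_int v :: 'p padic_int) dvd 1"
  using assms by (intro padic_unitI) (auto simp: padic_residue_of_int)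

lemma padic_divide_eqI:
  fixes x y z :: "'p::prime_card padic_int"
  assumes "y dvd 1" "z * y = x"
  shows "x / y = z"
  using padic_int_right_inverse[OF assms(1)] assms(2)
  by (metis divide_padic_int_def mult.assoc mult.right_neutral)

lemma padic_divide_mult_cancel:
  fixes x y :: "'p::prime_card padic_int"
  assumes "y dvd 1"
  shows "x / y * y = x"
  using padic_int_right_inverse[OF assms]
  by (metis divide_padic_int_def mult.assoc mult.commute mult.right_neutral)

lemma padic_unit_cancel:
  fixes x y z :: "'p::prime_card padic_int"
  assumes "y dvd 1" "x * y = z * y"
  shows "x = z"
  using assms padic_divide_eqI by metis

text \<open>Only meaningful on \<open>Zloc\<close>: otherwise the denominator is a non-unit, whose inverse is the junk value \<open>0\<close>.\<close>

definition padic_of_rat :: "rat \<Rightarrow> 'p::prime_card padic_int" where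
  "padic_of_rat x = of_int (fst (quotient_of x)) / of_int (snd (quotient_of x))"

context
  fixes P :: "'p::prime_card itself"
begin

interpretation rat_localization "CARD('p)"
  by unfold_locales (rule prime_card)

text \<open>Valid for every fraction with denominator prime to p, reduced or not, because the
  reduced denominator divides v. The homomorphism laws follow by clearing denominators and
  cancelling units.\<close>

lemma padic_of_rat_divide:
  assumes "\<not> int CARD('p) dvd v"
  shows "(padic_of_rat (of_int u / of_int v) :: 'p padic_int) * of_int v = of_int u"
proof -
  obtain a b where ab: "quotient_of (of_int u / of_int v) = (a, b)" by (metis surj_pair)
  have b: "b > 0" "coprime a b" and uv: "of_int u / of_int v = (of_int a / of_int b :: rat)"
    using quotient_of_denom_pos[OF ab] quotient_of_coprime[OF ab] quotient_of_div[OF ab] by auto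
  have "v \<noteq> 0" using assms by auto
  with uv b have "of_int (u * b) = (of_int (a * v) :: rat)" by (simp add: field_simps)
  then have eq: "u * b = a * v" by (simp only: of_int_eq_iff)
  then have "b dvd a * v" by (metis dvd_triv_right)
  then have "b dvd v" using b(2) by (simp add: coprime_commute coprime_dvd_mult_right_iff)
  then have "\<not> int CARD('p) dvd b" using assms dvd_trans by blast
  then have unit: "(of_int b :: 'p padic_int) dvd 1" by (rule padic_unit_of_int)
  have "padic_of_rat (of_int u / of_int v) * of_int b = (of_int a :: 'p padic_int)"
    unfolding padic_of_rat_def ab by (simp add: padic_divide_mult_cancel[OF unit])
  then have "(padic_of_rat (of_int u / of_int v) * of_int v) * of_int b = (of_int (a * v) :: 'p padic_int)"
    by (metis mult.assoc mult.commute of_int_mult)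
  also have "\<dots> = of_int u * of_int b" by (simp flip: eq)
  finally show ?thesis by (rule padic_unit_cancel[OF unit])
qed

lemma padic_of_rat_of_int: "padic_of_rat (of_int u) = (of_int u :: 'p padic_int)"
  using padic_of_rat_divide[of 1 u] not_dvd_one by simp

lemma padic_of_rat_numeral:
  "padic_of_rat 0 = (0 :: 'p padic_int)" "padic_of_rat 1 = (1 :: 'p padic_int)"
  "padic_of_rat (numeral k) = (numeral k :: 'p padic_int)" "padic_of_rat (of_nat n) = (of_nat n :: 'p padic_int)"
  using padic_of_rat_of_int[of 0] padic_of_rat_of_int[of 1] padic_of_rat_of_int[of "numeral k"]
    padic_of_rat_of_int[of "int n"] by simp_all

lemma padic_of_rat_add:
  assumes "x \<in> Zloc" "y \<in> Zloc"
  shows "padic_of_rat (x + y) = (padic_of_rat x + padic_of_rat y :: 'p padic_int)"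
proof -
  obtain u v where u: "\<not> int CARD('p) dvd v" "v \<noteq> 0" "x = of_int u / of_int v" using assms(1) by (rule Zloc_E)
  obtain u' v' where u': "\<not> int CARD('p) dvd v'" "v' \<noteq> 0" "y = of_int u' / of_int v'" using assms(2) by (rule Zloc_E)
  have dvd: "\<not> int CARD('p) dvd v * v'" using u u' not_dvd_mult by blast
  have "x + y = of_int (u * v' + u' * v) / of_int (v * v')" using u u' by (simp add: field_simps)
  then have "padic_of_rat (x + y) * of_int (v * v') = (of_int (u * v' + u' * v) :: 'p padic_int)"
    by (simp only: padic_of_rat_divide[OF dvd])
  also have "\<dots> = (padic_of_rat x * of_int v) * of_int v' + (padic_of_rat y * of_int v') * of_int v"
    using padic_of_rat_divide[OF u(1), of u] padic_of_rat_divide[OF u'(1), of u']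
    unfolding u(3)[symmetric] u'(3)[symmetric] by simp
  also have "\<dots> = (padic_of_rat x + padic_of_rat y) * of_int (v * v')"
    by (simp add: algebra_simps)
  finally show ?thesis by (rule padic_unit_cancel[OF padic_unit_of_int[OF dvd]])
qed

lemma padic_of_rat_mult:
  assumes "x \<in> Zloc" "y \<in> Zloc"
  shows "padic_of_rat (x * y) = (padic_of_rat x * padic_of_rat y :: 'p padic_int)"
proof -
  obtain u v where u: "\<not> int CARD('p) dvd v" "v \<noteq> 0" "x = of_int u / of_int v" using assms(1) by (rule Zloc_E)
  obtain u' v' where u': "\<not> int CARD('p) dvd v'" "v' \<noteq> 0" "y = of_int u' / of_int v'" using assms(2) by (rule Zloc_E)
  have dvd: "\<not> int CARD('p) dvd v * v'" using u u' not_dvd_mult by blast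
  have "x * y = of_int (u * u') / of_int (v * v')" using u u' by simp
  then have "padic_of_rat (x * y) * of_int (v * v') = (of_int (u * u') :: 'p padic_int)"
    by (simp only: padic_of_rat_divide[OF dvd])
  also have "\<dots> = (padic_of_rat x * of_int v) * (padic_of_rat y * of_int v')"
    using padic_of_rat_divide[OF u(1), of u] padic_of_rat_divide[OF u'(1), of u']
    unfolding u(3)[symmetric] u'(3)[symmetric] by simp
  also have "\<dots> = (padic_of_rat x * padic_of_rat y) * of_int (v * v')"
    by (simp add: mult_ac)
  finally show ?thesis by (rule padic_unit_cancel[OF padic_unit_of_int[OF dvd]])
qed

lemma padic_of_rat_uminus:
  assumes "x \<in> Zloc"
  shows "padic_of_rat (- x) = (- padic_of_rat x :: 'p padic_int)"
  using padic_of_rat_mult[of "-1" x] assms padic_of_rat_of_int[of "-1"] Zloc_of_int[of "-1"] by simp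

lemma padic_of_rat_diff:
  assumes "x \<in> Zloc" "y \<in> Zloc"
  shows "padic_of_rat (x - y) = (padic_of_rat x - padic_of_rat y :: 'p padic_int)"
  using padic_of_rat_add[of x "- y"] padic_of_rat_uminus[of y] assms by simp

lemma padic_of_rat_unit:
  assumes "x \<in> Zunits"
  shows "(padic_of_rat x :: 'p padic_int) dvd 1"
proof -
  have "(padic_of_rat x * padic_of_rat (inverse x) :: 'p padic_int) = padic_of_rat (x * inverse x)"
    using assms by (simp add: padic_of_rat_mult Zunit_Zloc)
  also have "\<dots> = 1" using Zunit_nonzero[OF assms] by (simp add: padic_of_rat_numeral)
  finally show ?thesis by (metis dvd_triv_left)
qed

lemma padic_of_rat_quotient:
  assumes "x \<in> Zloc" "y \<in> Zunits"
  shows "padic_of_rat (x / y) = (padic_of_rat x / padic_of_rat y :: 'p padic_int)"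
proof (rule padic_divide_eqI[symmetric])
  show "(padic_of_rat y :: 'p padic_int) dvd 1" using assms(2) by (rule padic_of_rat_unit)
  show "padic_of_rat (x / y) * padic_of_rat y = (padic_of_rat x :: 'p padic_int)"
    using assms Zunit_nonzero[OF assms(2)] by (simp add: Zunit_Zloc flip: padic_of_rat_mult)
qed

lemma padic_of_rat_power: "x \<in> Zloc \<Longrightarrow> padic_of_rat (x ^ k) = (padic_of_rat x ^ k :: 'p padic_int)"
  by (induction k) (simp_all add: padic_of_rat_mult padic_of_rat_numeral)

lemma padic_of_rat_sum:
  "(\<And>i. i \<in> A \<Longrightarrow> f i \<in> Zloc) \<Longrightarrow> padic_of_rat (sum f A) = (\<Sum>i\<in>A. padic_of_rat (f i) :: 'p padic_int)"
  by (induction A rule: infinite_finite_induct) (simp_all add: padic_of_rat_add padic_of_rat_numeral)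

lemma padic_of_rat_pochhammer:
  "x \<in> Zloc \<Longrightarrow> padic_of_rat (pochhammer x k) = (pochhammer (padic_of_rat x) k :: 'p padic_int)"
  by (induction k) (simp_all add: pochhammer_Suc padic_of_rat_mult padic_of_rat_add padic_of_rat_numeral)

lemma padic_of_rat_dvd:
  assumes "cong_mod m x 0"
  shows "of_nat CARD('p) ^ m dvd (padic_of_rat x :: 'p padic_int)"
proof -
  obtain z where "z \<in> Zloc" "x = of_nat CARD('p) ^ m * z" using assms by (auto simp: cong_zero_iff)
  then show ?thesis
    by (simp add: padic_of_rat_mult padic_of_rat_power padic_of_rat_numeral)
qed

end

section \<open>Values of the p-adic Gamma function modulo p\<close>

text \<open>Multiples of p count as 1 rather than being dropped, so that Gamma products run over
  full intervals, which can be shifted and concatenated.\<close>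

definition unit_part :: "nat \<Rightarrow> nat \<Rightarrow> int" where
  "unit_part p k = (if p dvd k then 1 else int k)"

definition gamma_int :: "nat \<Rightarrow> nat \<Rightarrow> int" where
  "gamma_int p n = (-1) ^ n * (\<Prod>k<n. unit_part p k)"

context
  fixes p :: nat
  assumes p: "prime p" "odd p"
begin

lemma unit_part_cong:
  assumes "p dvd m"
  shows "[unit_part p (k + m) = unit_part p k] (mod int m)"
  using assms by (simp add: unit_part_def dvd_add_left_iff cong_def)

lemma coprime_unit_part: "coprime (unit_part p k) (int (p ^ n))"
  using p(1) prime_imp_coprime[of p k] by (auto simp: unit_part_def coprime_commute)

text \<open>Sliding the window by one trades the factor at m for the one at m + p^n. The two are
  congruent and invertible modulo p^n, so they cancel.\<close>

lemma unit_part_block_periodic: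
  assumes "n > 0"
  shows "[(\<Prod>k\<in>{m..<m + p ^ n}. unit_part p k) = (\<Prod>k<p ^ n. unit_part p k)] (mod int (p ^ n))"
proof (induction m)
  case 0
  then show ?case by (simp add: atLeast0LessThan)
next
  case (Suc m)
  let ?B = "\<lambda>m. \<Prod>k\<in>{m..<m + p ^ n}. unit_part p k"
  have pos: "p ^ n > 0" using p(1) by (simp add: prime_gt_0_nat)
  have "?B (Suc m) * unit_part p m = (\<Prod>k\<in>{m..<Suc (m + p ^ n)}. unit_part p k)"
    using pos by (subst prod.atLeast_Suc_lessThan) (simp_all add: mult.commute)
  also have "\<dots> = ?B m * unit_part p (m + p ^ n)"
    using pos by simp
  finally have "?B (Suc m) * unit_part p m = ?B m * unit_part p (m + p ^ n)" .
  moreover have "[?B m * unit_part p (m + p ^ n) = ?B m * unit_part p m] (mod int (p ^ n))"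
    using assms by (intro cong_scalar_left unit_part_cong) simp
  ultimately have "[?B (Suc m) * unit_part p m = ?B m * unit_part p m] (mod int (p ^ n))"
    by simp
  then have "[?B (Suc m) = ?B m] (mod int (p ^ n))"
    using coprime_unit_part by (simp add: cong_mult_rcancel)
  with Suc.IH show ?case by (rule cong_trans[rotated])
qed

text \<open>Inversion modulo p^n permutes the residues prime to p, so their product equals the
  product of their inverses.\<close>

lemma unit_part_block_square:
  assumes "n > 0"
  shows "[(\<Prod>k<p ^ n. unit_part p k) ^ 2 = 1] (mod int (p ^ n))"
proof -
  let ?q = "p ^ n"
  have q: "?q > 1" using prime_gt_1_nat[OF p(1)] assms by (rule one_less_power)
  define A where "A = {k. k < ?q \<and> \<not> p dvd k}"
  have "\<exists>y. y \<in> A \<and> [k * y = 1] (mod ?q)" if "k \<in> A" for k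
  proof -
    have "coprime k ?q" using that p(1) prime_imp_coprime[of p k] by (auto simp: A_def coprime_commute)
    then obtain y where "[k * y = Suc 0] (mod ?q)" using cong_solve_coprime_nat by blast
    then have y: "[k * (y mod ?q) = 1] (mod ?q)" by (simp add: cong_def mod_simps)
    moreover have "\<not> p dvd y mod ?q"
    proof
      assume "p dvd y mod ?q"
      moreover have "[k * (y mod ?q) = 1] (mod p)" using y by (rule cong_dvd_modulus_nat) (use assms in simp)
      ultimately have "p dvd 1" by (metis cong_dvd_iff dvd_mult)
      then show False using p(1) by simp
    qed
    moreover have "y mod ?q < ?q" by (rule mod_less_divisor) (use q in linarith)
    ultimately show ?thesis by (auto simp: A_def)
  qed
  then obtain i where i: "\<And>k. k \<in> A \<Longrightarrow> i k \<in> A" "\<And>k. k \<in> A \<Longrightarrow> [k * i k = 1] (mod ?q)" by metis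
  have inv: "i (i k) = k" if "k \<in> A" for k
  proof -
    have "[i k * k = i k * i (i k)] (mod ?q)"
      using i(2)[OF that] i(2)[OF i(1)[OF that]] by (metis cong_sym cong_trans mult.commute)
    moreover have "coprime (i k) ?q"
      using i(1)[OF that] p(1) prime_imp_coprime[of p "i k"] by (auto simp: A_def coprime_commute)
    ultimately have "[k = i (i k)] (mod ?q)" by (simp add: cong_mult_lcancel_nat)
    moreover have "i (i k) \<in> A" using that i(1) by blast
    ultimately show ?thesis
      using that cong_less_modulus_unique_nat[of k "i (i k)" ?q] by (simp add: A_def)
  qed
  have "bij_betw i A A"
    by (rule bij_betw_byWitness[of _ i]) (use inv i(1) in auto)
  then have "(\<Prod>k\<in>A. int (i k)) = (\<Prod>k\<in>A. int k)"
    using prod.reindex_bij_betw[of i A A int] by simp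
  moreover have "[(\<Prod>k\<in>A. int k * int (i k)) = (\<Prod>k\<in>A. 1)] (mod int ?q)"
    by (rule cong_prod) (metis i(2) cong_int_iff of_nat_1 of_nat_mult)
  ultimately have "[(\<Prod>k\<in>A. int k) ^ 2 = 1] (mod int ?q)"
    by (simp add: prod.distrib power2_eq_square)
  moreover have "(\<Prod>k<?q. unit_part p k) = (\<Prod>k\<in>A. int k)"
    unfolding A_def unit_part_def by (simp add: prod.If_cases Int_def lessThan_def)
  ultimately show ?thesis by simp
qed

text \<open>The block consists of p^(n-1) blocks of length p, each -1 by Wilson's theorem, and their
  number is odd.\<close>

lemma unit_part_block_mod_prime:
  assumes "n > 0"
  shows "[(\<Prod>k<p ^ n. unit_part p k) = -1] (mod int p)"
proof -
  have W: "[(\<Prod>k<p. unit_part p k) = -1] (mod int p)"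
  proof -
    have "{..<p} = insert 0 {1..p - 1}" using p(1) prime_gt_0_nat[of p] by auto
    then have "(\<Prod>k<p. unit_part p k) = (\<Prod>k\<in>{1..p - 1}. unit_part p k)" by (simp add: unit_part_def)
    also have "\<dots> = (\<Prod>k\<in>{1..p - 1}. int k)"
    proof (intro prod.cong refl)
      fix k assume "k \<in> {1..p - 1}"
      then have "\<not> p dvd k" using nat_dvd_not_less[of k p] by force
      then show "unit_part p k = int k" by (simp add: unit_part_def)
    qed
    also have "\<dots> = fact (p - 1)" by (simp add: fact_prod)
    finally show ?thesis using wilson_theorem[OF p(1)] by simp
  qed
  have "[(\<Prod>k<j * p. unit_part p k) = (- 1) ^ j] (mod int p)" for j
  proof (induction j)
    case (Suc j)
    have "(\<Prod>k<Suc j * p. unit_part p k) = (\<Prod>k<j * p. unit_part p k) * (\<Prod>k\<in>{j * p..<j * p + p}. unit_part p k)"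
      unfolding lessThan_atLeast0 mult_Suc add.commute[of p]
      by (rule prod.atLeastLessThan_concat[symmetric]) simp_all
    moreover have "[(\<Prod>k\<in>{j * p..<j * p + p}. unit_part p k) = -1] (mod int p)"
      using cong_trans[OF unit_part_block_periodic[of 1 "j * p", simplified] W] .
    ultimately have "[(\<Prod>k<Suc j * p. unit_part p k) = (- 1) ^ j * (- 1)] (mod int p)"
      using cong_mult[OF Suc.IH] by (simp only:)
    then show ?case by simp
  qed simp
  note this[of "p ^ (n - 1)"]
  moreover have "p ^ (n - 1) * p = p ^ n" using assms by (cases n) simp_all
  moreover have "(- 1 :: int) ^ (p ^ (n - 1)) = - 1" using p(2) by simp
  ultimately show ?thesis by (simp only:)
qed

text \<open>Wilson's theorem for odd prime powers: p^n divides (W - 1)(W + 1), and W = -1 modulo p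
  makes W - 1 prime to p, so all of p^n divides W + 1.\<close>

lemma unit_part_block:
  assumes "n > 0"
  shows "[(\<Prod>k<p ^ n. unit_part p k) = -1] (mod int (p ^ n))"
proof -
  let ?W = "\<Prod>k<p ^ n. unit_part p k"
  have "int (p ^ n) dvd ?W ^ 2 - 1"
    using unit_part_block_square[OF assms] by (simp add: cong_iff_dvd_diff)
  then have dvd: "int (p ^ n) dvd (?W - 1) * (?W + 1)"
    by (simp add: power2_eq_square algebra_simps)
  have "int p dvd ?W + 1" using unit_part_block_mod_prime[OF assms] by (simp add: cong_iff_dvd_diff)
  moreover have "\<not> int p dvd 2"
    using p prime_ge_2_nat[OF p(1)] zdvd_imp_le[of "int p" 2] by (cases "p = 2") auto
  ultimately have "\<not> int p dvd ?W - 1"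
    using dvd_diff[of "int p" "?W + 1" "?W - 1"] by fastforce
  then have "coprime (int (p ^ n)) (?W - 1)"
    using p(1) prime_imp_coprime[of "int p" "?W - 1"] by simp
  with dvd have "int (p ^ n) dvd ?W + 1" by (simp add: coprime_dvd_mult_right_iff)
  then show ?thesis by (simp add: cong_iff_dvd_diff)
qed

text \<open>The sign (-1)^(p^n) = -1 cancels the value -1 of the additional block.\<close>

lemma gamma_int_shift:
  "[gamma_int p (m + p ^ n) = gamma_int p m] (mod int (p ^ n))"
proof (cases "n = 0")
  case False
  have "{..<m + p ^ n} = {..<m} \<union> {m..<m + p ^ n}" by auto
  then have "gamma_int p (m + p ^ n) = gamma_int p m * ((-1) ^ (p ^ n) * (\<Prod>k\<in>{m..<m + p ^ n}. unit_part p k))"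
    by (simp add: gamma_int_def power_add prod.union_disjoint ivl_disj_int mult_ac)
  moreover have "[(-1) ^ (p ^ n) * (\<Prod>k\<in>{m..<m + p ^ n}. unit_part p k) = (-1) * (-1)] (mod int (p ^ n))"
    using False p(2) cong_trans[OF unit_part_block_periodic unit_part_block, of n m]
    by (intro cong_mult) simp_all
  ultimately show ?thesis
    using cong_scalar_left[of _ "-1 * -1" "int (p ^ n)" "gamma_int p m"] by simp
qed simp

lemma gamma_int_cong:
  assumes "[m = m'] (mod p ^ n)"
  shows "[gamma_int p m = gamma_int p m'] (mod int (p ^ n))"
proof -
  have *: "[gamma_int p (m + j * p ^ n) = gamma_int p m] (mod int (p ^ n))" for m j
  proof (induction j)
    case (Suc j)
    then show ?case using gamma_int_shift[of "m + j * p ^ n" n]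
      by (metis add.assoc add.commute cong_trans mult_Suc)
  qed simp
  have "[gamma_int p k = gamma_int p (k mod p ^ n)] (mod int (p ^ n))" for k
    using *[of "k mod p ^ n" "k div p ^ n"] by (simp only: mod_div_mult_eq)
  from this[of m] this[of m'] show ?thesis
    using assms by (metis cong_def)
qed

lemma gamma_int_fact:
  assumes "0 < m" "m \<le> p"
  shows "gamma_int p m = (-1) ^ m * fact (m - 1)"
proof -
  have "{..<m} = insert 0 {1..m - 1}" using assms by auto
  then have "(\<Prod>k<m. unit_part p k) = (\<Prod>k\<in>{1..m - 1}. unit_part p k)" by (simp add: unit_part_def)
  also have "\<dots> = (\<Prod>k\<in>{1..m - 1}. int k)"
    using assms by (intro prod.cong) (auto simp: unit_part_def dest: dvd_imp_le)
  finally show ?thesis by (simp add: gamma_int_def fact_prod)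
qed

end

lemma padic_Gamma_nat_eq:
  "(padic_Gamma_nat n :: 'p::prime_card padic_int) = of_int (gamma_int CARD('p) n)"
proof -
  let ?A = "{k. 0 < k \<and> k < n \<and> \<not> CARD('p) dvd k}"
  have A: "?A = {..<n} \<inter> - {k. CARD('p) dvd k}"
    by (auto intro: gr0I)
  have "int (\<Prod>k\<in>?A. k) = (\<Prod>k<n. unit_part CARD('p) k)"
    unfolding unit_part_def A by (simp add: prod.If_cases)
  moreover have "(padic_Gamma_nat n :: 'p padic_int) = of_int ((-1) ^ n * int (\<Prod>k\<in>?A. k))"
    unfolding padic_Gamma_nat_def of_int_mult of_int_of_nat_eq by simp
  ultimately show ?thesis
    unfolding gamma_int_def by (simp only:)
qed

section \<open>Extension of the Gamma values from natural numbers by continuity\<close>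

lemma eventually_filtercomap_nhds_padic:
  fixes x :: "'p::prime_card padic_int"
  shows "eventually P (filtercomap f (nhds x)) \<longleftrightarrow>
    (\<exists>n. \<forall>m. padic_residue (f m) n = padic_residue x n \<longrightarrow> P m)"
proof
  assume "eventually P (filtercomap f (nhds x))"
  then obtain S where "open S" "x \<in> S" "\<And>m. f m \<in> S \<Longrightarrow> P m"
    unfolding eventually_filtercomap eventually_nhds by metis
  then show "\<exists>n. \<forall>m. padic_residue (f m) n = padic_residue x n \<longrightarrow> P m"
    unfolding open_padic_int_def by metis
next
  assume "\<exists>n. \<forall>m. padic_residue (f m) n = padic_residue x n \<longrightarrow> P m"
  then obtain n where n: "\<And>m. padic_residue (f m) n = padic_residue x n \<Longrightarrow> P m" by blast
  have "open {y. padic_residue y n = padic_residue x n}"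
    unfolding open_padic_int_def by (intro ballI exI[of _ n]) simp
  then have "eventually (\<lambda>y. padic_residue y n = padic_residue x n) (nhds x)"
    unfolding eventually_nhds by blast
  then show "eventually P (filtercomap f (nhds x))"
    unfolding eventually_filtercomap using n by blast
qed

text \<open>By \<open>gamma_int_cong\<close> the values at the truncations of x are compatible and
  define a p-adic integer \<open>L\<close>, which is the limit. Modulo p^n the Gamma function can
  therefore be read off at any natural number congruent to x.\<close>

lemma padic_Gamma_residue:
  fixes x :: "'p::prime_card padic_int"
  assumes odd: "odd CARD('p)" and m: "padic_residue (of_nat m :: 'p padic_int) n = padic_residue x n"
  shows "padic_residue (padic_Gamma x) n = padic_residue (padic_Gamma_nat m :: 'p padic_int) n"
proof -
  let ?p = "CARD('p)"
  have prime: "prime ?p" by (rule prime_card)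
  define r where "r n = nat (padic_residue x n)" for n
  have r: "int (r n) = padic_residue x n" for n
    using padic_residue_range(1)[of x n] by (simp add: r_def)
  have cong: "gamma_int ?p m mod int ?p ^ n = gamma_int ?p m' mod int ?p ^ n" if "[m = m'] (mod ?p ^ n)" for m m' n
    using gamma_int_cong[OF prime odd that] by (simp add: cong_def)
  have mod_eq: "[r k = r n] (mod ?p ^ n)" if "n \<le> k" for k n
    unfolding cong_int_iff[symmetric] r using padic_residue_mod_power[OF that, of x] by (simp add: cong_def)
  define g where "g n = gamma_int ?p (r n) mod int ?p ^ n" for n
  have "g n \<in> {0..<int ?p ^ n}" for n
    using card_prime_gt_1[where 'p='p] by (simp add: g_def)
  moreover have "g (Suc n) mod int ?p ^ n = g n" for n
    using cong[OF mod_eq[of n "Suc n"]] unfolding g_def by (simp add: mod_power_Suc_cancel del: power_Suc)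
  ultimately obtain L :: "'p padic_int" where L: "\<And>n. padic_residue L n = g n"
    using padic_of_residues[of g] by blast
  have gamma_L: "padic_residue (padic_Gamma_nat m :: 'p padic_int) n = padic_residue L n"
    if "padic_residue (of_nat m :: 'p padic_int) n = padic_residue x n" for m n
  proof -
    have "[m = r n] (mod ?p ^ n)"
      unfolding cong_int_iff[symmetric] r using that by (simp add: cong_def padic_residue_of_nat)
    then show ?thesis unfolding L g_def padic_Gamma_nat_eq padic_residue_of_int by (rule cong)
  qed
  have "((padic_Gamma_nat :: nat \<Rightarrow> 'p padic_int) \<longlongrightarrow> L) (filtercomap of_nat (nhds x))"
  proof (rule topological_tendstoI)
    fix S :: "'p padic_int set" assume "open S" "L \<in> S"
    then obtain n where "\<And>y. padic_residue y n = padic_residue L n \<Longrightarrow> y \<in> S"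
      unfolding open_padic_int_def by blast
    then show "eventually (\<lambda>m. padic_Gamma_nat m \<in> S) (filtercomap of_nat (nhds x))"
      unfolding eventually_filtercomap_nhds_padic using gamma_L by blast
  qed
  \<comment> \<open>A limit is unique only along a nontrivial filter; the truncation
    \<open>r n\<close> is a natural number in the given neighbourhood of x.\<close>
  moreover have "filtercomap (of_nat :: nat \<Rightarrow> 'p padic_int) (nhds x) \<noteq> bot"
    unfolding trivial_limit_def eventually_filtercomap_nhds_padic
  proof safe
    fix n assume "\<forall>m. padic_residue (of_nat m :: 'p padic_int) n = padic_residue x n \<longrightarrow> False"
    moreover have "padic_residue (of_nat (r n) :: 'p padic_int) n = padic_residue x n"
      by (simp add: padic_residue_of_nat r)
    ultimately show False by blast
  qed
  ultimately have "padic_Gamma x = L"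
    unfolding padic_Gamma_def by (intro tendsto_Lim) simp_all
  then show ?thesis using gamma_L[OF m] by simp
qed

section \<open>The series with parameters summing to a multiple of the base\<close>

lemma pochhammer_reverse:
  fixes x :: "'a::field_char_0"
  assumes "k \<le> n" "pochhammer (1 - x - of_nat n) k \<noteq> 0"
  shows "pochhammer x (n - k) = (-1) ^ k * pochhammer x n / pochhammer (1 - x - of_nat n) k"
proof -
  have "pochhammer x n = pochhammer x (n - k) * pochhammer (x + of_nat (n - k)) k"
    using pochhammer_product[of "n - k" n x] assms(1) by simp
  also have "pochhammer (x + of_nat (n - k)) k = (-1) ^ k * pochhammer (1 - x - of_nat n) k"
    using pochhammer_minus[of "x + of_nat n - 1" k] assms(1) by (simp add: of_nat_diff algebra_simps)
  finally show ?thesis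
    using assms(2) by (simp add: mult.assoc flip: power_add)
qed

lemma of_nat_binomial_pochhammer:
  "(of_nat (n choose k) :: 'a::field_char_0) = (-1) ^ k * pochhammer (- of_nat n) k / fact k"
  by (simp add: binomial_gbinomial gbinomial_pochhammer)

text \<open>The parameters are b = a + y, c = (1 + a)/2, d = a - y, e = a + t, with -n = a - t.
  Reading the balanced sum backwards exposes (N - k + 1)_k, which up to sign is (-N)_k; thus a sum
  of length n shrinks to length N.\<close>

lemma well_poised_special:
  fixes a t y :: "'a::field_char_0"
  assumes a: "a = t - of_nat n" and N: "2 * of_nat N = 1 - 5 * a" "N \<le> n"
    and nz: "\<And>j::nat. a + of_nat j \<noteq> 0" "\<And>j::nat. 1 - y + of_nat j \<noteq> 0" "\<And>j::nat. 1 + y + of_nat j \<noteq> 0"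
      "\<And>j::nat. 1 - t + of_nat j \<noteq> 0" "\<And>j::nat. (1 + a) / 2 + of_nat j \<noteq> 0"
      "\<And>j::nat. 2 * a + y + of_nat j \<noteq> 0" "\<And>j::nat. 2 * a - y + of_nat j \<noteq> 0"
      "\<And>j::nat. (1 + 3 * a) / 2 + of_nat j \<noteq> 0"
  shows "(\<Sum>k\<le>n. (a + 2 * of_nat k) * pochhammer a k / fact k
      * (pochhammer (a + t) k * pochhammer (a - t) k / (pochhammer (1 - t) k * pochhammer (1 + t) k))
      * (pochhammer (a + y) k * pochhammer (a - y) k / (pochhammer (1 - y) k * pochhammer (1 + y) k)))
    = pochhammer a (Suc n) * pochhammer (1 - a - t - y) n * pochhammer (1 - a - t + y) n * pochhammer ((1 - a) / 2 - t) n
      / (pochhammer (1 - t) n * pochhammer (1 - y) n * pochhammer (1 + y) n * pochhammer ((1 + a) / 2) n)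
      * (\<Sum>k\<le>N. pochhammer (- of_nat N) k * pochhammer a k * pochhammer (a + t) k * pochhammer (a - t) k
        / (fact k * pochhammer (2 * a + y) k * pochhammer (2 * a - y) k * pochhammer ((1 + 3 * a) / 2) k))"
    (is "?L = ?E * sum ?v _")
proof -
  \<comment> \<open>This value satisfies 1 + a - c = c, so it drops out of the well-poised side
    while still supplying the half-integral parameters of the other side.\<close>
  let ?c = "(1 + a) / 2"
  have n: "of_nat n = t - a" using a by simp
  have q: "1 + a - (a + y) = 1 - y" "1 + a - ?c = ?c" "1 + a - (a - y) = 1 + y" "1 + a - (a + t) = 1 - t"
    "1 + a + of_nat n = 1 + t" "- of_nat n = a - t"
    by (simp_all add: n field_simps)
  have pnz: "pochhammer (1 - y) k \<noteq> 0" "pochhammer (1 + y) k \<noteq> 0" "pochhammer (1 - t) k \<noteq> 0" "pochhammer ?c k \<noteq> 0"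
    "pochhammer a k \<noteq> 0" "pochhammer (2 * a + y) k \<noteq> 0" "pochhammer (2 * a - y) k \<noteq> 0" 
    "pochhammer ((1 + 3 * a) / 2) k \<noteq> 0" for k
    using nz by (auto intro!: pochhammer_nonzero)
  have "?L = (\<Sum>k\<le>n. well_poised_term a (a + y) ?c (a - y) (a + t) n k)"
  proof (rule sum.cong[OF refl])
    fix k
    have "X * A / F * (B * C / (D * G)) * (H * I / (J * K)) = X * (A * H * Z * I * B * C) / (F * J * Z * K * D * G)"
      if "Z \<noteq> 0" for X A F B C D G H I J K Z :: 'a
      using that by (simp add: mult_ac)
    from this[OF pnz(4)] show "(a + 2 * of_nat k) * pochhammer a k / fact k
      * (pochhammer (a + t) k * pochhammer (a - t) k / (pochhammer (1 - t) k * pochhammer (1 + t) k))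
      * (pochhammer (a + y) k * pochhammer (a - y) k / (pochhammer (1 - y) k * pochhammer (1 + y) k))
      = well_poised_term a (a + y) ?c (a - y) (a + t) n k"
      unfolding well_poised_term_def q .
  qed
  also have "\<dots> = pochhammer a (Suc n) / (pochhammer (1 - y) n * pochhammer ?c n * pochhammer (1 + y) n)
      * (\<Sum>j\<le>n. balanced_term a (a + y) ?c (a - y) (a + t) n j)"
    by (subst well_poised_balanced_transformation) (use nz in \<open>simp_all only: q not_False_eq_True\<close>)
  also have "(\<Sum>j\<le>n. balanced_term a (a + y) ?c (a - y) (a + t) n j)
      = (\<Sum>k\<le>n. balanced_term a (a + y) ?c (a - y) (a + t) n (n - k))"
    by (rule sum.reindex_bij_witness[of _ "\<lambda>k. n - k" "\<lambda>k. n - k"]) auto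
  also have "\<dots> = (\<Sum>k\<le>n. pochhammer (1 - a - t - y) n * pochhammer (1 - a - t + y) n * pochhammer ((1 - a) / 2 - t) n
      / pochhammer (1 - t) n * ?v k)"
  proof (rule sum.cong[OF refl])
    fix k assume "k \<in> {..n}"
    then have k: "k \<le> n" by simp
    have b: "1 + a - (a + y) - (a + t) = 1 - a - t - y" "1 + a - ?c - (a + t) = (1 - a) / 2 - t"
      "1 + a - (a - y) - (a + t) = 1 - a - t + y" "1 + a - (a + t) = 1 - t"
      "2 + 2 * a - (a + y) - ?c - (a - y) - (a + t) + of_nat (n - k) = of_nat N - of_nat k + 1"
      using k N by (simp_all add: of_nat_diff n field_simps)
    have s: "1 - (1 - a - t - y) - of_nat n = 2 * a + y" "1 - (1 - a - t + y) - of_nat n = 2 * a - y"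
      "1 - ((1 - a) / 2 - t) - of_nat n = (1 + 3 * a) / 2" "1 - (1 - t) - of_nat n = a"
      by (simp_all add: n field_simps)
    have r: "pochhammer (1 - a - t - y) (n - k) = (-1) ^ k * pochhammer (1 - a - t - y) n / pochhammer (2 * a + y) k"
      "pochhammer (1 - a - t + y) (n - k) = (-1) ^ k * pochhammer (1 - a - t + y) n / pochhammer (2 * a - y) k"
      "pochhammer ((1 - a) / 2 - t) (n - k) = (-1) ^ k * pochhammer ((1 - a) / 2 - t) n / pochhammer ((1 + 3 * a) / 2) k"
      "pochhammer (1 - t) (n - k) = (-1) ^ k * pochhammer (1 - t) n / pochhammer a k"
      using pochhammer_reverse[OF k, of "1 - a - t - y"] pochhammer_reverse[OF k, of "1 - a - t + y"]
        pochhammer_reverse[OF k, of "(1 - a) / 2 - t"] pochhammer_reverse[OF k, of "1 - t"] pnz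
      unfolding s by blast+
    have m: "pochhammer (of_nat N - of_nat k + 1) k = (-1) ^ k * pochhammer (- of_nat N :: 'a) k"
      by (simp add: pochhammer_minus mult.assoc[symmetric] flip: power_add)
    have kk: "n choose (n - k) = n choose k" "n - (n - k) = k" using k by (simp_all add: binomial_symmetric[symmetric])
    \<comment> \<open>\<open>e\<close> stands for (-1)^k: reversal produces six such signs, which
      cancel in pairs.\<close>
    have "e * B / F * D * (e * M) * (e * X / Q1 * (e * Z / Q3) * (e * Y / Q2)) / (e * T / A)
        = X * Y * Z / T * (M * A * D * B / (F * Q1 * Q2 * Q3))"
      if "e * e = 1" for e B F D M X Y Z Q1 Q2 Q3 T A :: 'a
    proof -
      have "e \<noteq> 0" and "inverse e = e" using that by (auto simp: inverse_unique)
      then have "e * B / F * D * (e * M) * (e * X / Q1 * (e * Z / Q3) * (e * Y / Q2)) / (e * T / A)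
        = (e * e) * (e * e) * (e * e) * (X * Y * Z / T * (M * A * D * B / (F * Q1 * Q2 * Q3)))"
        by (simp add: divide_inverse mult_ac)
      then show ?thesis using that by simp
    qed
    note alg = this
    show "balanced_term a (a + y) ?c (a - y) (a + t) n (n - k) = pochhammer (1 - a - t - y) n * pochhammer (1 - a - t + y) n * pochhammer ((1 - a) / 2 - t) n
      / pochhammer (1 - t) n * ?v k"
      unfolding balanced_term_def unfolding b unfolding r m kk of_nat_binomial_pochhammer unfolding q
      by (rule alg) (simp flip: power_add)
  qed
  also have "\<dots> = pochhammer (1 - a - t - y) n * pochhammer (1 - a - t + y) n * pochhammer ((1 - a) / 2 - t) n
      / pochhammer (1 - t) n * (\<Sum>k\<le>n. ?v k)"
    by (simp only: sum_distrib_left)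
  also have "(\<Sum>k\<le>n. ?v k) = (\<Sum>k\<le>N. ?v k)"
    using N(2) by (intro sum.mono_neutral_right) (auto simp: pochhammer_of_nat_eq_0_iff)
  finally show ?thesis by (simp add: mult_ac)
qed

section \<open>Factorials and products modulo p\<close>

context rat_localization
begin

lemma cong_zeroI: "z \<in> Zloc \<Longrightarrow> cong_mod m (of_nat p ^ m * z) 0"
  unfolding cong_zero_iff by blast

lemma cong_prime_multiple: "z \<in> Zloc \<Longrightarrow> cong_mod 1 (of_nat p * z) 0"
  using cong_zeroI[of z 1] by simp

lemma Zunit_fact: "k < p \<Longrightarrow> fact k \<in> Zunits"
  using Zunit_of_nat[of "fact k"] prime_dvd_fact_iff[OF prime_p] by simp

lemma Zloc_fact [simp]: "fact k \<in> Zloc"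
  using Zloc_of_nat[of "fact k"] by simp

text \<open>Starting from Wilson's theorem, moving one factor from the second factorial to the first
  replaces k + 1 by i + 1 = -(k + 1) modulo p and so flips the sign.\<close>

lemma cong_fact_mult:
  assumes "i + k = p - 1"
  shows "cong_mod 1 (fact i * fact k) ((-1) ^ Suc i)"
  using assms
proof (induction i arbitrary: k)
  case 0
  have "[fact (p - 1) = - 1] (mod int p)" using wilson_theorem[OF prime_p] .
  then obtain z where z: "fact (p - 1) - (- 1 :: int) = int p * z" by (auto simp: cong_iff_dvd_diff)
  have "fact (p - 1) - (- 1 :: rat) = of_int (fact (p - 1) - (- 1))" by simp
  also have "\<dots> = of_nat p * of_int z" unfolding z by simp
  finally show ?case using 0 unfolding cong_mod_def by (intro bexI[of _ "of_int z"]) simp_all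
next
  case (Suc i)
  have IH: "cong_mod 1 (fact i * fact (Suc k)) ((-1) ^ Suc i)"
    using Suc.prems by (intro Suc.IH) simp
  have p: "of_nat (Suc i) + of_nat (Suc k) = (of_nat p :: rat)"
    using Suc.prems prime_gt_0_nat[OF prime_p] by (simp flip: of_nat_add of_nat_Suc)
  have "cong_mod 1 (of_nat p * (fact i * fact k)) 0"
    by (rule cong_prime_multiple) simp
  from cong_diff[OF this IH] have "cong_mod 1 (fact (Suc i) * fact k) ((-1) ^ Suc (Suc i))"
    unfolding p[symmetric] by (simp add: algebra_simps)
  then show ?case .
qed

text \<open>The omitted factor is x + s = p. The factors below it complete (x - 1)! to (p - 1)!, and
  those above are p + 1, ..., p + l, congruent to l!.\<close>

lemma cong_skip_product:
  assumes "x + s = p" "x > 0"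
  shows "cong_mod 1 ((\<Prod>i\<in>{..<s + 1 + l} - {s}. of_nat x + of_nat i) * fact (x - 1)) (fact (p - 1) * fact l)"
proof -
  have set: "{..<s + 1 + l} - {s} = {..<s} \<union> {s + 1..<s + 1 + l}" by auto
  have "(\<Prod>i\<in>{..<s + 1 + l} - {s}. of_nat x + of_nat i :: rat)
      = (\<Prod>i<s. of_nat x + of_nat i) * (\<Prod>i\<in>{s + 1..<s + 1 + l}. of_nat x + of_nat i)"
    unfolding set by (rule prod.union_disjoint) auto
  also have "(\<Prod>i\<in>{s + 1..<s + 1 + l}. of_nat x + of_nat i :: rat) = (\<Prod>i<l. of_nat (x + s) + of_nat (Suc i))"
    by (rule prod.reindex_bij_witness[of _ "\<lambda>i. i + (s + 1)" "\<lambda>i. i - (s + 1)"]) auto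
  also have "(\<Prod>i<s. of_nat x + of_nat i :: rat) * (\<Prod>i<l. of_nat (x + s) + of_nat (Suc i)) * fact (x - 1)
      = fact (p - 1) * (\<Prod>i<l. of_nat p + of_nat (Suc i))"
  proof -
    have "fact (p - 1) = (pochhammer 1 (x - 1 + s) :: rat)"
      using assms by (simp add: pochhammer_fact)
    also have "\<dots> = fact (x - 1) * pochhammer (of_nat x) s"
      unfolding pochhammer_product' pochhammer_fact using assms(2) by (simp add: of_nat_diff)
    finally show ?thesis using assms(1) by (simp add: pochhammer_prod atLeast0LessThan mult_ac)
  qed
  finally have eq: "(\<Prod>i\<in>{..<s + 1 + l} - {s}. of_nat x + of_nat i) * fact (x - 1)
    = (fact (p - 1) * (\<Prod>i<l. of_nat p + of_nat (Suc i)) :: rat)" .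
  have "cong_mod 1 (\<Prod>i<l. of_nat p + of_nat (Suc i)) (\<Prod>i<l. 0 + of_nat (Suc i))"
    using cong_prime_multiple[of 1] by (intro cong_prod cong_add) (simp_all del: of_nat_Suc)
  moreover have "(\<Prod>i<l. 0 + of_nat (Suc i) :: rat) = fact l"
    by (simp add: fact_prod_Suc atLeast0LessThan)
  ultimately show ?thesis
    unfolding eq by (intro cong_scale) simp_all
qed

text \<open>Adding a factor turns D into x i + D + T D x i, whose mixed term vanishes modulo p
  because T does. It is applied with T = t^2.\<close>

lemma prod_one_plus_expansion:
  assumes "finite J" "\<And>j. j \<in> J \<Longrightarrow> x j \<in> Zloc" "cong_mod 1 T 0" "T \<in> Zloc"
  shows "\<exists>D\<in>Zloc. (\<Prod>j\<in>J. 1 + T * x j) = 1 + T * D \<and> cong_mod 1 D (\<Sum>j\<in>J. x j)"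
  using assms(1,2)
proof (induction J)
  case empty
  show ?case by (intro bexI[of _ 0]) simp_all
next
  case (insert i J)
  then obtain D where D: "D \<in> Zloc" "(\<Prod>j\<in>J. 1 + T * x j) = 1 + T * D" "cong_mod 1 D (\<Sum>j\<in>J. x j)" by auto
  have "cong_mod 1 (x i + D + (D * x i) * T) (x i + (\<Sum>j\<in>J. x j) + (D * x i) * 0)"
    using insert.prems D assms(3) by (intro cong_add cong_scale) simp_all
  then show ?case using insert D assms(4)
    by (intro bexI[of _ "x i + D + (D * x i) * T"]) (simp_all add: algebra_simps)
qed

end

section \<open>The truncated series\<close>

text \<open>The condition p = 2r modulo 5 enters as integrality of n, because 3 (2r) - r = 5r.
  \<open>N\<close> is the length of the sum on the right-hand side.\<close>

locale truncated_sum = rat_localization +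
  fixes r :: int and n N :: nat
  assumes odd_p: "odd p" and r_le: "r \<le> 1" and r_5: "\<not> 5 dvd r"
    and n_def: "5 * int n = 3 * int p - r" and even_n: "even n"
    and N_def: "2 * int N = 1 - r" and p_ge: "5 - r \<le> 2 * int p"
begin

definition t :: rat where "t = 3 * of_nat p / 5"
definition a :: rat where "a = of_int r / 5"
definition w :: "nat \<Rightarrow> rat" where "w k = (a + 2 * of_nat k) * pochhammer a k / fact k"
definition \<psi> :: "rat \<Rightarrow> nat \<Rightarrow> rat" where
  "\<psi> y k = pochhammer (a + y) k * pochhammer (a - y) k / (pochhammer (1 - y) k * pochhammer (1 + y) k)"
definition V :: "rat \<Rightarrow> rat" where
  "V y = (\<Sum>k\<le>N. pochhammer (- of_nat N) k * pochhammer a k * pochhammer (a + t) k * pochhammer (a - t) k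
        / (fact k * pochhammer (2 * a + y) k * pochhammer (2 * a - y) k * pochhammer ((1 + 3 * a) / 2) k))"

lemma r_eq: "of_int r = (3 * of_nat p - 5 * of_nat n :: rat)"
proof -
  have "r = 3 * int p - 5 * int n" using n_def by simp
  then have "of_int r = (of_int (3 * int p - 5 * int n) :: rat)" by (simp only:)
  then show ?thesis by simp
qed

lemma a_eq: "a = t - of_nat n"
  by (simp add: a_def t_def r_eq field_simps)

lemma N_eq: "2 * of_nat N = 1 - 5 * a"
proof -
  have "2 * of_nat N = (of_int (2 * int N) :: rat)" by simp
  also have "\<dots> = of_int (1 - r)" by (rule arg_cong[OF N_def])
  finally show ?thesis by (simp add: a_def)
qed

text \<open>The second and third inequality are each equivalent to p \<ge> (5 - r)/2. They keep
  (2a)_k and ((1 + 3a)/2)_k prime to p for k \<le> N.\<close>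

lemma n_less: "n < p" and two_n: "p + N \<le> 2 * n" and three_n: "p + 1 + 2 * N \<le> 3 * n"
  using n_def N_def p_ge r_le by linarith+

lemma p_gt: "p > 2"
  using prime_ge_2_nat[OF prime_p] odd_p by (cases "p = 2") auto

text \<open>Apart from p itself these are the numerators, over 5 or 10, of parameters of the series.
  As 3p = r modulo 5, each is r times a unit modulo 5.\<close>

lemma not_5_dvd:
  "\<not> 5 dvd int p" "\<not> 5 dvd 5 - 3 * int p" "\<not> 5 dvd 5 + r" "\<not> 5 dvd 5 + 3 * r" "\<not> 5 dvd 2 * r"
  "\<not> 5 dvd 2 * r + 3 * int p" "\<not> 5 dvd 2 * r - 3 * int p"
proof -
  have p3: "3 * int p = r + 5 * int n" using n_def by simp
  have cr: "\<not> 5 dvd - 1 * r" "\<not> 5 dvd 1 * r" "\<not> 5 dvd 2 * r" "\<not> 5 dvd 3 * r"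
    using r_5 by presburger+
  have m: "\<not> 5 dvd c * r + 5 * v" if "\<not> 5 dvd c * r" for c v :: int
    using that dvd_add_left_iff[of 5 "5 * v" "c * r"] by simp
  have *: "5 - 3 * int p = - 1 * r + 5 * (1 - int n)" "5 + r = 1 * r + 5 * 1" "5 + 3 * r = 3 * r + 5 * 1"
    "2 * r + 3 * int p = 3 * r + 5 * int n" "2 * r - 3 * int p = 1 * r + 5 * (- int n)"
    unfolding p3 by (simp_all add: algebra_simps)
  show "\<not> 5 dvd int p"
  proof
    assume "5 dvd int p"
    then have "5 dvd 1 * r + 5 * int n" using p3 dvd_mult[of 5 "int p" 3] by simp
    with m[OF cr(2)] show False by contradiction
  qed
  show "\<not> 5 dvd 5 - 3 * int p" unfolding *(1) by (rule m, rule cr)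
  show "\<not> 5 dvd 5 + r" unfolding *(2) by (rule m, rule cr)
  show "\<not> 5 dvd 5 + 3 * r" unfolding *(3) by (rule m, rule cr)
  show "\<not> 5 dvd 2 * r" by (rule cr)
  show "\<not> 5 dvd 2 * r + 3 * int p" unfolding *(4) by (rule m, rule cr)
  show "\<not> 5 dvd 2 * r - 3 * int p" unfolding *(5) by (rule m, rule cr)
qed

section \<open>Units and nonvanishing among the parameters\<close>

lemma Zunit_2 [simp]: "2 \<in> Zunits" and Zunit_5 [simp]: "5 \<in> Zunits"
proof -
  have "\<not> p dvd 2" using p_gt by (auto dest: dvd_imp_le)
  then show "2 \<in> Zunits" using Zunit_of_nat[of 2] by simp
  have "\<not> p dvd 5"
  proof
    assume "p dvd 5"
    then have "p = 5" by (intro primes_dvd_imp_eq prime_p) simp_all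
    then show False using not_5_dvd(1) by simp
  qed
  then show "5 \<in> Zunits" using Zunit_of_nat[of 5] by simp
qed

lemma Zloc_t [simp]: "t \<in> Zloc" and Zloc_a [simp]: "a \<in> Zloc"
  unfolding t_def a_def by (simp_all add: Zloc_divide)

lemma t_cong: "cong_mod 1 t 0"
  using cong_prime_multiple[of "3 / 5"] by (simp add: t_def field_simps)

lemma a_cong: "cong_mod 1 a (- of_nat n)"
  using cong_diff[OF t_cong cong_refl[of 1 "of_nat n"]] by (simp add: a_eq)

lemma Zunit_I_cong: "cong_mod 1 x (of_int u) \<Longrightarrow> x \<in> Zloc \<Longrightarrow> \<not> int p dvd u \<Longrightarrow> x \<in> Zunits"
  using cong_unit[OF cong_sym] Zunit_of_int by blast

lemma Zunit_pochhammer: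
  assumes "\<And>j. j < k \<Longrightarrow> x + of_nat j \<in> Zunits"
  shows "pochhammer x k \<in> Zunits"
  unfolding pochhammer_prod by (rule Zunit_prod) (use assms in simp)

lemma not_dvd_between: "0 < u \<Longrightarrow> u < int p \<Longrightarrow> \<not> int p dvd u"
  using zdvd_imp_le by force

lemma a_add_unit: "j < n \<Longrightarrow> a + of_nat j \<in> Zunits"
proof -
  assume j: "j < n"
  have "cong_mod 1 (a + of_nat j) (of_int (- (int n - int j)))"
    using cong_add[OF a_cong cong_refl[of 1 "of_nat j"]] j by simp
  then show ?thesis
    by (rule Zunit_I_cong) (use j n_less not_dvd_between[of "int n - int j"] in \<open>simp_all add: dvd_diff_commute\<close>)
qed

lemma one_add_unit: "j < n \<Longrightarrow> 1 + of_nat j \<in> Zunits"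
  using Zunit_of_nat[of "Suc j"] n_less nat_dvd_not_less[of "Suc j" p] by simp

text \<open>A fraction over 5v whose numerator is prime to 5 is never an integer; v is 1 or 2
  below.\<close>

lemma not_int_shift:
  fixes x :: rat
  assumes "5 * of_int v * x = of_int u" "\<not> 5 dvd u"
  shows "x + of_nat j \<noteq> 0"
proof
  assume "x + of_nat j = 0"
  then have "x = - of_nat j" by (rule eq_neg_iff_add_eq_0[THEN iffD2])
  then have x: "x = of_int (- int j)" by simp
  have "of_int (5 * v * (- int j)) = (5 * of_int v * x :: rat)" unfolding x by simp
  also have "\<dots> = of_int u" by (rule assms(1))
  finally have "5 * (v * - int j) = u" unfolding of_int_eq_iff mult.assoc .
  then have "5 dvd u" by (rule dvdI[OF sym])
  with assms(2) show False by contradiction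
qed

text \<open>Nonvanishing is required for every j, but only in the rationals: it follows from
  positivity for 1 + j and 1 + t + j, and from \<open>not_int_shift\<close> otherwise.\<close>

lemma special_sum:
  assumes y: "y = 0 \<or> y = t"
  shows "(\<Sum>k\<le>n. w k * \<psi> t k * \<psi> y k) =
    pochhammer a (Suc n) * pochhammer (1 - a - t - y) n * pochhammer (1 - a - t + y) n * pochhammer ((1 - a) / 2 - t) n
      / (pochhammer (1 - t) n * pochhammer (1 - y) n * pochhammer (1 + y) n * pochhammer ((1 + a) / 2) n) * V y"
proof -
  have tp: "t > 0" using p_gt by (simp add: t_def)
  note ni = not_int_shift
  have nat1: "1 + of_nat j \<noteq> (0 :: rat)" "1 + t + of_nat j \<noteq> 0" for j
  proof -
    have "0 < (1 + of_nat j :: rat)" "0 < 1 + t + of_nat j" using tp by (simp_all add: add_pos_nonneg)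
    then show "1 + of_nat j \<noteq> (0 :: rat)" "1 + t + of_nat j \<noteq> 0" by simp_all
  qed
  have 1: "a + of_nat j \<noteq> 0" for j by (rule ni[OF _ r_5, of 1]) (simp add: a_def)
  have 2: "1 - t + of_nat j \<noteq> 0" for j by (rule ni[OF _ not_5_dvd(2), of 1]) (simp add: t_def field_simps)
  have 3: "(1 + a) / 2 + of_nat j \<noteq> 0" for j
    by (rule ni[OF _ not_5_dvd(3), of 2]) (simp add: a_def field_simps)
  have 4: "(1 + 3 * a) / 2 + of_nat j \<noteq> 0" for j
    by (rule ni[OF _ not_5_dvd(4), of 2]) (simp add: a_def field_simps)
  have 5: "2 * a + of_nat j \<noteq> 0" for j by (rule ni[OF _ not_5_dvd(5), of 1]) (simp add: a_def)
  have 6: "2 * a + t + of_nat j \<noteq> 0" for j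
    by (rule ni[OF _ not_5_dvd(6), of 1]) (simp add: a_def t_def field_simps)
  have 7: "2 * a - t + of_nat j \<noteq> 0" for j
    by (rule ni[OF _ not_5_dvd(7), of 1]) (simp add: a_def t_def field_simps)
  have "N \<le> n" using two_n n_less by linarith
  have 8: "1 - y + of_nat j \<noteq> 0" "1 + y + of_nat j \<noteq> 0" "2 * a + y + of_nat j \<noteq> 0" "2 * a - y + of_nat j \<noteq> 0" for j
    using y 2 5 6 7 nat1 by auto
  note P = well_poised_special[where a = a and t = t and n = n and N = N and y = y]
  note P2 = P[OF a_eq N_eq \<open>N \<le> n\<close> 1 8(1) 8(2) 2 3 8(3) 8(4) 4]
  show ?thesis
    unfolding V_def w_def \<psi>_def by (fact P2)
qed

section \<open>The tail and the squared remainder modulo p^5\<close>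

lemma tail_term:
  assumes "n < k" "k < p"
  shows "cong_mod 5 ((a + 2 * of_nat k) * (pochhammer a k ^ 5 / fact k ^ 5)) 0"
proof -
  define z where "z = (\<Prod>j\<in>{..<k} - {n}. a + of_nat j)"
  have "pochhammer a k = (a + of_nat n) * z"
    unfolding pochhammer_prod z_def atLeast0LessThan using assms(1) by (intro prod.remove) auto
  then have pz: "pochhammer a k = of_nat p * (3 / 5 * z)"
    by (simp add: a_eq t_def)
  have "(a + 2 * of_nat k) * (pochhammer a k ^ 5 / fact k ^ 5)
      = of_nat p ^ 5 * ((a + 2 * of_nat k) * ((3 / 5 * z) ^ 5 / fact k ^ 5))"
    unfolding pz power_mult_distrib by simp
  moreover have "z \<in> Zloc" unfolding z_def by (intro Zloc_prod) simp
  then have "(a + 2 * of_nat k) * ((3 / 5 * z) ^ 5 / fact k ^ 5) \<in> Zloc"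
    using assms(2) by (intro Zloc_mult Zloc_divide Zunit_power Zunit_fact Zloc_power Zloc_add) simp_all
  ultimately show ?thesis by (simp only: cong_zeroI)
qed

lemma pochhammer_neg_binomial: "pochhammer (- of_nat n) k / fact k = ((-1) ^ k * of_nat (n choose k) :: rat)"
  unfolding of_nat_binomial_pochhammer by (simp flip: power_add)

lemma ratio_cong: "k \<le> n \<Longrightarrow> cong_mod 1 (pochhammer a k / fact k) ((-1) ^ k * of_nat (n choose k))"
  unfolding pochhammer_neg_binomial[symmetric]
  using n_less by (intro cong_divide cong_pochhammer a_cong Zunit_fact) simp_all

definition harm2 :: "nat \<Rightarrow> rat" where "harm2 k = (\<Sum>j<k. 1 / (1 + of_nat j) ^ 2)"

lemma harm2_reverse: "k \<le> n \<Longrightarrow> (\<Sum>j<k. 1 / (of_nat n - of_nat j) ^ 2) = harm2 n - harm2 (n - k)"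
proof (induction k)
  case (Suc k)
  obtain m where m: "n = Suc (k + m)" using Suc.prems by (metis Suc_le_D add_Suc le_Suc_ex)
  show ?case using Suc unfolding m by (simp add: harm2_def algebra_simps)
qed simp

lemma psi_zero: "\<psi> 0 k = (pochhammer a k / fact k) ^ 2"
  by (simp add: \<psi>_def pochhammer_fact power2_eq_square)

lemma pochhammer_conj: "pochhammer (x + y) k * pochhammer (x - y) k = (\<Prod>j<k. (x + of_nat j) ^ 2 - y ^ 2)" for x y :: rat
  unfolding pochhammer_prod prod.distrib[symmetric] atLeast0LessThan
  by (intro prod.cong) (simp_all add: power2_eq_square algebra_simps)

lemma one_add_minus_t_unit: "j < n \<Longrightarrow> (1 + of_nat j) ^ 2 - t ^ 2 \<in> Zunits"
proof -
  assume j: "j < n"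
  have "cong_mod 1 ((1 + of_nat j) ^ 2 - 0 ^ 2) ((1 + of_nat j) ^ 2 - t ^ 2)"
    by (intro cong_diff cong_refl cong_power cong_sym[OF t_cong]) simp_all
  moreover have "(1 + of_nat j :: rat) ^ 2 - 0 ^ 2 \<in> Zunits" using one_add_unit[OF j] by simp
  ultimately show ?thesis by (rule cong_unit) simp
qed

text \<open>Conjugate factors combine to (a + j)^2 - t^2 and (1 + j)^2 - t^2, so only t^2 occurs.
  Its coefficient involves the sum of 1/(1 + j)^2 - 1/(a + j)^2; replacing a by -n modulo p turns
  this into harmonic sums symmetric under k \<mapsto> n - k.\<close>

lemma psi_difference:
  assumes k: "k \<le> n"
  obtains D where "D \<in> Zloc" "\<psi> 0 k - \<psi> t k = t ^ 2 * D"
    "cong_mod 1 D (of_nat (n choose k) ^ 2 * (harm2 n - harm2 k - harm2 (n - k)))"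
proof -
  \<comment> \<open>Solved from the requirement that the j-th factor of \<open>\<psi> t k\<close> be
    its value at t = 0 times 1 + t^2 x j.\<close>
  define x where "x j = ((a + of_nat j) ^ 2 - (1 + of_nat j) ^ 2) / (((1 + of_nat j) ^ 2 - t ^ 2) * (a + of_nat j) ^ 2)" for j
  have u: "a + of_nat j \<in> Zunits" "1 + of_nat j \<in> Zunits" "(1 + of_nat j) ^ 2 - t ^ 2 \<in> Zunits" if "j < k" for j
    using that k a_add_unit one_add_unit one_add_minus_t_unit by auto
  note nz = u[THEN Zunit_nonzero]
  have x: "x j \<in> Zloc" if "j < k" for j
    unfolding x_def using u[OF that] by (intro Zloc_divide Zunit_mult Zunit_power Zloc_diff Zloc_power) (simp_all add: Zunit_Zloc)
  have T: "cong_mod 1 (t ^ 2) 0" using cong_power[OF t_cong, of 2] by simp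
  obtain D where D: "D \<in> Zloc" "(\<Prod>j<k. 1 + t ^ 2 * x j) = 1 + t ^ 2 * D" "cong_mod 1 D (\<Sum>j<k. x j)"
    using prod_one_plus_expansion[of "{..<k}" x "t ^ 2"] x T by auto
  have "\<psi> t k = (\<Prod>j<k. ((a + of_nat j) ^ 2 - t ^ 2) / ((1 + of_nat j) ^ 2 - t ^ 2))"
    unfolding \<psi>_def pochhammer_conj prod_dividef mult.commute[of "pochhammer (1 - t) k"] ..
  also have "\<dots> = (\<Prod>j<k. (a + of_nat j) ^ 2 / (1 + of_nat j) ^ 2 * (1 + t ^ 2 * x j))"
  proof (rule prod.cong[OF refl])
    fix j assume "j \<in> {..<k}"
    then have j: "j < k" by simp
    have "(A - T) / (B - T) = A / B * (1 + T * ((A - B) / ((B - T) * A)))"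
      if "A \<noteq> 0" "B \<noteq> 0" "B - T \<noteq> 0" for A B T :: rat
      using that by (simp add: divide_simps) (simp add: algebra_simps)
    then show "((a + of_nat j) ^ 2 - t ^ 2) / ((1 + of_nat j) ^ 2 - t ^ 2)
      = (a + of_nat j) ^ 2 / (1 + of_nat j) ^ 2 * (1 + t ^ 2 * x j)"
      unfolding x_def using nz[OF j] by simp
  qed
  also have "\<dots> = \<psi> 0 k * (1 + t ^ 2 * D)"
  proof -
    have "(\<Prod>j<k. (a + of_nat j) ^ 2 / (1 + of_nat j) ^ 2) = \<psi> 0 k"
      unfolding psi_zero pochhammer_fact pochhammer_prod atLeast0LessThan
      by (simp add: prod_dividef prod_power_distrib power_divide)
    then show ?thesis unfolding prod.distrib D(2) by simp
  qed
  finally have eq: "\<psi> 0 k - \<psi> t k = t ^ 2 * (- (\<psi> 0 k * D))" by (simp add: algebra_simps)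
  have psi0: "\<psi> 0 k \<in> Zloc"
    unfolding psi_zero using k n_less by (intro Zloc_power Zloc_divide Zunit_fact) simp_all
  have "cong_mod 1 (\<psi> 0 k) (((-1) ^ k * of_nat (n choose k)) ^ 2)"
    unfolding psi_zero using k n_less by (intro cong_power ratio_cong Zloc_divide Zunit_fact) simp_all
  then have psi0c: "cong_mod 1 (\<psi> 0 k) (of_nat (n choose k) ^ 2)"
    by (simp add: power_mult_distrib flip: power_mult)
  have xc: "cong_mod 1 (x j) (1 / (1 + of_nat j) ^ 2 - 1 / (of_nat n - of_nat j) ^ 2)" if j: "j < k" for j
  proof -
    have un: "(of_nat n - of_nat j :: rat) \<in> Zunits"
      using Zunit_of_nat[of "n - j"] j k n_less nat_dvd_not_less[of "n - j" p] by (simp add: of_nat_diff)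
    have ac: "cong_mod 1 ((a + of_nat j) ^ 2) ((of_nat n - of_nat j) ^ 2)"
      using cong_power[OF cong_add[OF a_cong cong_refl[of 1 "of_nat j"]], of 2] by (simp add: power2_commute)
    have "cong_mod 1 (x j) (((of_nat n - of_nat j) ^ 2 - (1 + of_nat j) ^ 2)
        / (((1 + of_nat j) ^ 2 - 0) * (of_nat n - of_nat j) ^ 2))"
      unfolding x_def using u[OF j] un
      by (intro cong_divide cong_diff cong_mult ac T cong_refl Zunit_mult) (simp_all add: Zunit_Zloc)
    moreover have "((of_nat n - of_nat j) ^ 2 - (1 + of_nat j) ^ 2)
        / (((1 + of_nat j) ^ 2 - 0) * (of_nat n - of_nat j) ^ 2)
        = (1 / (1 + of_nat j) ^ 2 - 1 / (of_nat n - of_nat j) ^ 2 :: rat)"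
      using Zunit_nonzero[OF un] nz(2)[OF j] by (simp add: diff_divide_distrib)
    ultimately show ?thesis by simp
  qed
  have h: "(\<Sum>j<k. 1 / (1 + of_nat j) ^ 2 - 1 / (of_nat n - of_nat j) ^ 2) = - (harm2 n - harm2 k - harm2 (n - k))"
    unfolding sum_subtractf harm2_reverse[OF k] by (simp add: harm2_def)
  have "cong_mod 1 D (- (harm2 n - harm2 k - harm2 (n - k)))"
    using cong_trans[OF D(3) cong_sum[OF xc]] unfolding h[symmetric] by simp
  moreover have "harm2 k' \<in> Zloc" if "k' \<le> n" for k'
    unfolding harm2_def using that one_add_unit by (intro Zloc_sum Zloc_divide Zunit_power) simp_all
  ultimately have "cong_mod 1 (\<psi> 0 k * D) (of_nat (n choose k) ^ 2 * (- (harm2 n - harm2 k - harm2 (n - k))))"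
    using psi0c psi0 k by (intro cong_mult) simp_all
  then have "cong_mod 1 (- (\<psi> 0 k * D)) (of_nat (n choose k) ^ 2 * (harm2 n - harm2 k - harm2 (n - k)))"
    using cong_uminus unfolding mult_minus_right by fastforce
  with eq psi0 D(1) show ?thesis by (intro that[of "- (\<psi> 0 k * D)"]) simp_all
qed

lemma psi_square_sum: "cong_mod 5 (\<Sum>k\<le>n. w k * (\<psi> 0 k - \<psi> t k) ^ 2) 0"
proof -
  define Q where "Q k = (2 * of_nat k - of_nat n) * ((-1) ^ k * of_nat (n choose k))
    * (of_nat (n choose k) ^ 2 * (harm2 n - harm2 k - harm2 (n - k))) ^ 2" for k
  have "\<exists>D. D \<in> Zloc \<and> \<psi> 0 k - \<psi> t k = t ^ 2 * D \<and>
    cong_mod 1 D (of_nat (n choose k) ^ 2 * (harm2 n - harm2 k - harm2 (n - k)))" if "k \<le> n" for k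
    using psi_difference[OF that] by metis
  then obtain D where D: "\<And>k. k \<le> n \<Longrightarrow> D k \<in> Zloc" "\<And>k. k \<le> n \<Longrightarrow> \<psi> 0 k - \<psi> t k = t ^ 2 * D k"
    "\<And>k. k \<le> n \<Longrightarrow> cong_mod 1 (D k) (of_nat (n choose k) ^ 2 * (harm2 n - harm2 k - harm2 (n - k)))"
    by metis
  have h: "harm2 k' \<in> Zloc" if "k' \<le> n" for k'
    unfolding harm2_def using that one_add_unit by (intro Zloc_sum Zloc_divide Zunit_power) simp_all
  have "cong_mod 1 (w k * D k ^ 2) (Q k)" if k: "k \<le> n" for k
  proof -
    have "cong_mod 1 ((a + 2 * of_nat k) * (pochhammer a k / fact k) * D k ^ 2) ((- of_nat n + 2 * of_nat k) * ((-1) ^ k * of_nat (n choose k))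
    * (of_nat (n choose k) ^ 2 * (harm2 n - harm2 k - harm2 (n - k))) ^ 2)"
      using k n_less h D(1)
      by (intro cong_mult cong_power cong_add a_cong cong_refl ratio_cong D(3) Zloc_mult Zloc_divide Zunit_fact) simp_all
    then show ?thesis by (simp add: w_def Q_def)
  qed
  then have "cong_mod 1 (\<Sum>k\<le>n. w k * D k ^ 2) (\<Sum>k\<le>n. Q k)" by (intro cong_sum) simp
  moreover have "(\<Sum>k\<le>n. Q k) = 0"
  proof -
    have "(\<Sum>k\<le>n. Q k) = (\<Sum>k\<le>n. Q (n - k))"
      by (rule sum.reindex_bij_witness[of _ "\<lambda>k. n - k" "\<lambda>k. n - k"]) auto
    also have "\<dots> = (\<Sum>k\<le>n. - Q k)"
    proof (rule sum.cong[OF refl])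
      fix k assume "k \<in> {..n}"
      then have k: "k \<le> n" by simp
      \<comment> \<open>Evenness of n keeps the sign symmetric, so that the factor 2k - n alone
        changes sign.\<close>
      have "(-1 :: rat) ^ (n - k) = (-1) ^ k" using k even_n by (simp add: uminus_power_if)
      then show "Q (n - k) = - Q k"
        using k unfolding Q_def binomial_symmetric[OF k, symmetric] by (simp add: of_nat_diff algebra_simps)
    qed
    also have "\<dots> = - (\<Sum>k\<le>n. Q k)" by (simp add: sum_negf)
    finally show ?thesis by simp
  qed
  ultimately have "cong_mod 1 ((3 / 5) ^ 4 * (\<Sum>k\<le>n. w k * D k ^ 2)) ((3 / 5) ^ 4 * 0)"
    by (intro cong_scale) simp_all
  from cong_power_scale[OF this, of 4]
  have "cong_mod 5 (of_nat p ^ 4 * ((3 / 5) ^ 4 * (\<Sum>k\<le>n. w k * D k ^ 2))) 0" by simp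
  moreover have "of_nat p ^ 4 * ((3 / 5) ^ 4 * (\<Sum>k\<le>n. w k * D k ^ 2)) = (\<Sum>k\<le>n. w k * (\<psi> 0 k - \<psi> t k) ^ 2)"
    unfolding sum_distrib_left
  proof (rule sum.cong[OF refl])
    fix k assume "k \<in> {..n}"
    then have d: "\<psi> 0 k - \<psi> t k = t ^ 2 * D k" using D(2) by simp
    show "of_nat p ^ 4 * ((3 / 5) ^ 4 * (w k * D k ^ 2)) = w k * (\<psi> 0 k - \<psi> t k) ^ 2"
      unfolding d by (simp add: t_def power_mult_distrib power_divide flip: power_mult)
  qed
  ultimately show ?thesis by simp
qed

lemma truncated_sum_cong:
  "cong_mod 5 (\<Sum>k<p. (a + 2 * of_nat k) * (pochhammer a k ^ 5 / fact k ^ 5))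
    (2 * (\<Sum>k\<le>n. w k * \<psi> t k * \<psi> 0 k) - (\<Sum>k\<le>n. w k * \<psi> t k * \<psi> t k))"
proof -
  let ?f = "\<lambda>k. (a + 2 * of_nat k) * (pochhammer a k ^ 5 / fact k ^ 5)"
  have "{..<p} = {..n} \<union> {n<..<p}" using n_less by auto
  then have split: "(\<Sum>k<p. ?f k) = (\<Sum>k\<le>n. ?f k) + (\<Sum>k\<in>{n<..<p}. ?f k)"
    by (simp add: sum.union_disjoint ivl_disj_int)
  have "cong_mod 5 (\<Sum>k\<in>{n<..<p}. ?f k) (\<Sum>k\<in>{n<..<p}. 0)"
    by (intro cong_sum tail_term) simp_all
  then have "cong_mod 5 (\<Sum>k<p. ?f k) ((\<Sum>k\<le>n. ?f k) + 0)"
    unfolding split by (intro cong_add cong_refl) simp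
  also have "(\<Sum>k\<le>n. ?f k) + 0 = (\<Sum>k\<le>n. w k * (\<psi> 0 k - \<psi> t k) ^ 2)
      + (2 * (\<Sum>k\<le>n. w k * \<psi> t k * \<psi> 0 k) - (\<Sum>k\<le>n. w k * \<psi> t k * \<psi> t k))"
    unfolding sum_distrib_left sum_subtractf[symmetric] sum.distrib[symmetric] add_0_right
  proof (rule sum.cong[OF refl])
    fix k
    have "?f k = w k * \<psi> 0 k ^ 2"
      by (simp add: w_def psi_zero power_divide eval_nat_numeral)
    then show "?f k = w k * (\<psi> 0 k - \<psi> t k) ^ 2 + (2 * (w k * \<psi> t k * \<psi> 0 k) - w k * \<psi> t k * \<psi> t k)"
      by (simp add: power2_eq_square algebra_simps)
  qed
  also have "cong_mod 5 \<dots> (0 + (2 * (\<Sum>k\<le>n. w k * \<psi> t k * \<psi> 0 k) - (\<Sum>k\<le>n. w k * \<psi> t k * \<psi> t k)))"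
    by (intro cong_add psi_square_sum cong_refl)
  finally show ?thesis by simp
qed

section \<open>The closed product and its residue modulo p\<close>

text \<open>
  The factors of \<open>(1 - a - t \<plusminus> y)\<^sub>n\<close> and of \<open>((1 - a) / 2 - t)\<^sub>n\<close> that are divisible by \<open>p\<close> have the
  indices \<open>j0\<close> and \<open>j1\<close>, respectively.
\<close>

definition j0 :: nat where "j0 = p - 1 - n"
definition j1 :: nat where "j1 = j0 div 2"

lemma j_facts: "j0 = 2 * j1" "p = n + 2 * j1 + 1" "j0 < n" "j1 < n" "2 * j1 + 1 \<le> n" "j1 + 1 \<le> n"
proof -
  have "even (p - 1 - n)" using odd_p even_n n_less by simp
  then show 1: "j0 = 2 * j1" by (simp add: j1_def j0_def)
  then show 2: "p = n + 2 * j1 + 1" using n_less by (simp add: j0_def)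
  show "j0 < n" using 1 2 two_n by linarith
  then show "j1 < n" "2 * j1 + 1 \<le> n" "j1 + 1 \<le> n" using 1 by linarith+
qed

lemma p_rat: "of_nat p = (of_nat n + 2 * of_nat j1 + 1 :: rat)"
  by (subst j_facts(2)) simp

text \<open>The product in \<open>special_sum\<close> after removing its four multiples of p: the
  last factor a + n = t of (a)_(n+1), two factors at \<open>j0\<close> and one at
  \<open>j1\<close>.\<close>

definition unit_factor :: "rat \<Rightarrow> rat" where
  "unit_factor y = pochhammer a n * (\<Prod>j\<in>{..<n} - {j0}. 1 - a - t - y + of_nat j)
    * (\<Prod>j\<in>{..<n} - {j0}. 1 - a - t + y + of_nat j) * (\<Prod>j\<in>{..<n} - {j1}. (1 - a) / 2 - t + of_nat j)
    / (pochhammer (1 - t) n * pochhammer (1 - y) n * pochhammer (1 + y) n * pochhammer ((1 + a) / 2) n)"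

lemma special_sum_factored:
  assumes "y = 0 \<or> y = t"
  shows "(\<Sum>k\<le>n. w k * \<psi> t k * \<psi> y k)
    = t * ((of_nat p - 2 * t) ^ 2 - y ^ 2) * ((of_nat p - 3 * t) / 2) * unit_factor y * V y"
proof -
  have split: "pochhammer x n = (x + of_nat i) * (\<Prod>j\<in>{..<n} - {i}. x + of_nat j)" if "i < n" for x :: rat and i
    unfolding pochhammer_prod atLeast0LessThan using that by (intro prod.remove) auto
  have n: "of_nat n = of_nat p - 1 - 2 * (of_nat j1 :: rat)" by (simp add: p_rat)
  have 1: "1 - a - t - y + of_nat j0 = of_nat p - 2 * t - y" "1 - a - t + y + of_nat j0 = of_nat p - 2 * t + y"
    "(1 - a) / 2 - t + of_nat j1 = (of_nat p - 3 * t) / 2"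
    by (simp_all add: j_facts(1) a_eq n field_simps)
  have 2: "pochhammer a (Suc n) = t * pochhammer a n"
    by (simp add: pochhammer_Suc a_eq)
  have alg: "t * X * ((P - y) * A) * ((P + y) * B) * (Q * C) / D * v = t * (P ^ 2 - y ^ 2) * Q * (X * A * B * C / D) * v"
    for X P A B C D Q v :: rat
    by (simp add: divide_inverse power2_eq_square algebra_simps)
  show ?thesis
    unfolding special_sum[OF assms] 2 split[OF j_facts(3), of "1 - a - t - y"] split[OF j_facts(3), of "1 - a - t + y"]
      split[OF j_facts(4), of "(1 - a) / 2 - t"] 1 unit_factor_def
    by (rule alg)
qed

definition unit_residue :: rat where
  "unit_residue = pochhammer (- of_nat n) n * (\<Prod>j\<in>{..<n} - {j0}. of_nat (n + 1) + of_nat j) ^ 2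
    * (\<Prod>j\<in>{..<n} - {j1}. of_nat (n + j1 + 1) + of_nat j) / (fact n ^ 3 * pochhammer (of_nat (j1 + 1)) n)"

text \<open>With n even, (1 + n)/2 and (1 - n)/2 are half-integers; adding p/2 turns them into the
  integers n + j1 + 1 and j1 + 1, ready for factorials.\<close>

lemma cong_sub_half_p:
  assumes "x \<in> Zloc"
  shows "cong_mod 1 x (x + of_nat p / 2)"
  using cong_add[OF cong_refl cong_sym[OF cong_prime_multiple[of "1 / 2"]], of x] by simp

lemma Zunit_shift: "pochhammer (of_nat (j1 + 1)) n \<in> Zunits"
proof (rule Zunit_pochhammer)
  fix j assume "j < n"
  then have "\<not> p dvd j1 + 1 + j" using j_facts nat_dvd_not_less[of "j1 + 1 + j" p] by linarith
  then show "of_nat (j1 + 1) + of_nat j \<in> Zunits" using Zunit_of_nat[of "j1 + 1 + j"] by (simp add: add.assoc)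
qed

lemma unit_factor_cong:
  assumes y: "y \<in> Zloc" "cong_mod 1 y 0"
  shows "cong_mod 1 (unit_factor y) unit_residue" "unit_factor y \<in> Zloc"
proof -
  have tl: "cong_mod 1 (1 + y) 1" "cong_mod 1 (1 - y) 1" "cong_mod 1 (1 - t) 1"
    using cong_add[OF cong_refl[of 1 1] y(2)] cong_diff[OF cong_refl[of 1 1] y(2)] cong_diff[OF cong_refl[of 1 1] t_cong]
    by simp_all
  have c0: "cong_mod 1 (1 - a - t) (of_nat (n + 1))"
    using cong_diff[OF cong_diff[OF cong_refl[of 1 1] a_cong] t_cong] by (simp add: add.commute)
  have c1: "cong_mod 1 (1 - a - t - y) (of_nat (n + 1))" "cong_mod 1 (1 - a - t + y) (of_nat (n + 1))"
    using cong_diff[OF c0 y(2)] cong_add[OF c0 y(2)] by simp_all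
  have c2: "cong_mod 1 ((1 - a) / 2 - t) (of_nat (n + j1 + 1))"
  proof -
    have "cong_mod 1 ((1 - a) / 2 - t) ((1 - - of_nat n) / 2 - 0)"
      by (intro cong_diff cong_divide cong_refl a_cong t_cong) simp_all
    also have "cong_mod 1 \<dots> ((1 - - of_nat n) / 2 - 0 + of_nat p / 2)" by (rule cong_sub_half_p) simp
    also have "(1 - - of_nat n) / 2 - 0 + of_nat p / 2 = (of_nat (n + j1 + 1) :: rat)" by (simp add: p_rat field_simps)
    finally show ?thesis .
  qed
  have c3: "cong_mod 1 ((1 + a) / 2) (of_nat (j1 + 1))"
  proof -
    have "cong_mod 1 ((1 + a) / 2) ((1 + - of_nat n) / 2)"
      by (intro cong_add cong_divide cong_refl a_cong) simp_all
    also have "cong_mod 1 \<dots> ((1 + - of_nat n) / 2 + of_nat p / 2)" by (rule cong_sub_half_p) simp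
    also have "(1 + - of_nat n) / 2 + of_nat p / 2 = (of_nat (j1 + 1) :: rat)" by (simp add: p_rat field_simps)
    finally show ?thesis .
  qed
  have f: "pochhammer 1 n \<in> Zunits"
    unfolding pochhammer_fact[symmetric] using n_less by (rule Zunit_fact)
  have loc: "1 - t \<in> Zloc" "1 - y \<in> Zloc" "1 + y \<in> Zloc" "(1 + a) / 2 \<in> Zloc" using y by simp_all
  have u: "pochhammer (1 - t) n \<in> Zunits" "pochhammer (1 - y) n \<in> Zunits" "pochhammer (1 + y) n \<in> Zunits"
    "pochhammer ((1 + a) / 2) n \<in> Zunits"
    using cong_unit[OF cong_sym[OF cong_pochhammer[OF tl(3)]] f] cong_unit[OF cong_sym[OF cong_pochhammer[OF tl(2)]] f]
      cong_unit[OF cong_sym[OF cong_pochhammer[OF tl(1)]] f] cong_unit[OF cong_sym[OF cong_pochhammer[OF c3]] Zunit_shift]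
      loc by simp_all
  show "unit_factor y \<in> Zloc"
    unfolding unit_factor_def using u y(1) by (intro Zloc_divide Zloc_mult Zloc_prod Zunit_mult) simp_all
  have "cong_mod 1 (unit_factor y) (pochhammer (- of_nat n) n * (\<Prod>j\<in>{..<n} - {j0}. of_nat (n + 1) + of_nat j)
    * (\<Prod>j\<in>{..<n} - {j0}. of_nat (n + 1) + of_nat j)
    * (\<Prod>j\<in>{..<n} - {j1}. of_nat (n + j1 + 1) + of_nat j)
    / (pochhammer 1 n * pochhammer 1 n * pochhammer 1 n * pochhammer (of_nat (j1 + 1)) n))"
    unfolding unit_factor_def using u f Zunit_shift y(1)
    by (intro cong_divide cong_mult cong_prod cong_add cong_pochhammer cong_refl a_cong c1 c2 c3 tl Zunit_mult
        Zloc_prod Zloc_mult) (simp_all add: Zunit_Zloc)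
  then show "cong_mod 1 (unit_factor y) unit_residue"
    by (simp add: unit_residue_def pochhammer_fact[symmetric] power2_eq_square power3_eq_cube mult_ac)
qed

section \<open>The short sum modulo p\<close>

definition V0 :: rat where
  "V0 = (\<Sum>k\<le>N. pochhammer (- of_nat N) k * pochhammer a k ^ 3
        / (fact k * pochhammer (2 * a) k ^ 2 * pochhammer ((1 + 3 * a) / 2) k))"

text \<open>Modulo p the factor 2a + j is -(2n - j), and 2n - j lies strictly between p and
  2p.\<close>

lemma two_a_unit: "k \<le> N \<Longrightarrow> pochhammer (2 * a) k \<in> Zunits"
proof (rule Zunit_pochhammer)
  fix j assume "k \<le> N" "j < k"
  then have j: "p + j < 2 * n" using two_n by simp
  have "cong_mod 1 (2 * a + of_nat j) (2 * (- of_nat n) + of_nat j)"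
    by (intro cong_add cong_scale a_cong) simp_all
  also have "2 * (- of_nat n) + of_nat j = (of_int (- (int (2 * n) - int j)) :: rat)" by simp
  finally show "2 * a + of_nat j \<in> Zunits"
  proof (rule Zunit_I_cong)
    have "\<not> int p dvd int (2 * n) - int j - int p"
      by (rule not_dvd_between) (use j n_less in linarith)+
    then have "\<not> int p dvd int (2 * n) - int j" by (metis dvd_diff dvd_refl)
    then show "\<not> int p dvd - (int (2 * n) - int j)" by (simp only: dvd_minus_iff) simp
  qed simp
qed

text \<open>Modulo p the factor is -u/2 with u = 3n - 1 - 2j strictly between p and 3p. The only
  multiple of p there is 2p, which is even, while u is odd.\<close>

lemma three_a_unit: "k \<le> N \<Longrightarrow> pochhammer ((1 + 3 * a) / 2) k \<in> Zunits"
proof (rule Zunit_pochhammer)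
  fix j assume "k \<le> N" "j < k"
  then have "j + 1 \<le> N" by simp
  then have j: "p + 1 + 2 * (j + 1) \<le> 3 * n" by (intro order_trans[OF _ three_n]) simp
  define u where "u = 3 * int n - 1 - 2 * int j"
  have "cong_mod 1 ((1 + 3 * a) / 2 + of_nat j) ((1 + 3 * (- of_nat n)) / 2 + of_nat j)"
    by (intro cong_add cong_divide cong_scale a_cong cong_refl) simp_all
  also have "(1 + 3 * (- of_nat n)) / 2 + of_nat j = (of_int (- u) / 2 :: rat)" by (simp add: u_def field_simps)
  finally have c: "cong_mod 1 ((1 + 3 * a) / 2 + of_nat j) (of_int (- u) / 2)" .
  have "\<not> int p dvd u"
  proof
    assume "int p dvd u"
    then obtain v where v: "u = int p * v" ..
    have "odd u" using even_n by (simp add: u_def)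
    then have "odd v" unfolding v by simp
    have pos: "0 < int p" using p_gt by simp
    have "int p * 1 < int p * v" "int p * v < int p * 3"
      unfolding v[symmetric] using j n_less by (simp_all add: u_def)
    then have "1 < v" "v < 3" using pos by (simp_all only: mult_less_cancel_left_pos)
    then have "v = 2" by simp
    with \<open>odd v\<close> show False by simp
  qed
  then have "of_int (- u) / 2 \<in> Zunits" by (intro Zunit_divide Zunit_of_int) simp_all
  with cong_sym[OF c] show "(1 + 3 * a) / 2 + of_nat j \<in> Zunits" by (rule cong_unit) simp
qed

lemma N_less: "N < p"
  using two_n n_less by linarith

lemma Zunit_25 [simp]: "25 \<in> Zunits"
  using Zunit_mult[OF Zunit_5 Zunit_5] by simp

lemma V0_Zloc: "V0 \<in> Zloc"
  unfolding V0_def using two_a_unit three_a_unit N_less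
  by (intro Zloc_sum Zloc_divide Zloc_mult Zunit_mult Zunit_power Zunit_fact) simp_all

lemma V_cong:
  assumes y: "y \<in> Zloc" "cong_mod 1 y 0"
  shows "cong_mod 1 (V y) V0"
proof -
  have c: "cong_mod 1 (2 * a + y) (2 * a)" "cong_mod 1 (2 * a - y) (2 * a)" "cong_mod 1 (a + t) a" "cong_mod 1 (a - t) a"
    using cong_add[OF cong_refl[of 1 "2 * a"] y(2)] cong_diff[OF cong_refl[of 1 "2 * a"] y(2)]
      cong_add[OF cong_refl[of 1 a] t_cong] cong_diff[OF cong_refl[of 1 a] t_cong] by simp_all
  have "cong_mod 1 (V y) (\<Sum>k\<le>N. pochhammer (- of_nat N) k * pochhammer a k * pochhammer a k * pochhammer a k
        / (fact k * pochhammer (2 * a) k * pochhammer (2 * a) k * pochhammer ((1 + 3 * a) / 2) k))"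
    unfolding V_def
  proof (rule cong_sum)
    fix k assume "k \<in> {..N}"
    then have k: "k \<le> N" by simp
    have u: "pochhammer (2 * a + y) k \<in> Zunits" "pochhammer (2 * a - y) k \<in> Zunits" "fact k \<in> Zunits"
      using cong_unit[OF cong_sym[OF cong_pochhammer[OF c(1)]] two_a_unit[OF k]]
        cong_unit[OF cong_sym[OF cong_pochhammer[OF c(2)]] two_a_unit[OF k]] Zunit_fact N_less k y(1) by simp_all
    show "cong_mod 1 (pochhammer (- of_nat N) k * pochhammer a k * pochhammer (a + t) k * pochhammer (a - t) k
        / (fact k * pochhammer (2 * a + y) k * pochhammer (2 * a - y) k * pochhammer ((1 + 3 * a) / 2) k))
      (pochhammer (- of_nat N) k * pochhammer a k * pochhammer a k * pochhammer a k
        / (fact k * pochhammer (2 * a) k * pochhammer (2 * a) k * pochhammer ((1 + 3 * a) / 2) k))"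
      using u two_a_unit[OF k] three_a_unit[OF k] y(1)
      by (intro cong_divide cong_mult cong_pochhammer cong_refl c Zunit_mult) (simp_all add: Zunit_Zloc)
  qed
  then show ?thesis by (simp add: V0_def power2_eq_square power3_eq_cube mult_ac)
qed

text \<open>The coefficient -6/25 is t (p - 3t)/2 divided by p^2.\<close>

lemma special_sum_cong:
  assumes "y = 0 \<or> y = t" "(of_nat p - 2 * t) ^ 2 - y ^ 2 = c * of_nat p ^ 2" "c \<in> Zloc"
  shows "cong_mod 5 (\<Sum>k\<le>n. w k * \<psi> t k * \<psi> y k) (of_nat p ^ 4 * (- 6 / 25 * c * (unit_residue * V0)))"
proof -
  have y: "y \<in> Zloc" "cong_mod 1 y 0" using assms(1) t_cong by auto
  have "(\<Sum>k\<le>n. w k * \<psi> t k * \<psi> y k) = of_nat p ^ 4 * (- 6 / 25 * c * (unit_factor y * V y))"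
    unfolding special_sum_factored[OF assms(1)] assms(2) by (simp add: t_def eval_nat_numeral)
  also have "cong_mod 5 \<dots> (of_nat p ^ 4 * (- 6 / 25 * c * (unit_residue * V0)))"
  proof -
    have "cong_mod 1 (- 6 / 25 * c * (unit_factor y * V y)) (- 6 / 25 * c * (unit_residue * V0))"
      by (intro cong_scale cong_mult unit_factor_cong V_cong y V0_Zloc Zloc_mult assms(3)) simp
    from cong_power_scale[OF this, of 4] show ?thesis by simp
  qed
  finally show ?thesis .
qed

lemma truncated_sum_main:
  "cong_mod 5 (\<Sum>k<p. (a + 2 * of_nat k) * (pochhammer a k ^ 5 / fact k ^ 5))
    (- 12 / 125 * of_nat p ^ 4 * unit_residue * V0)"
proof -
  \<comment> \<open>Since p - 2t = -p/5 and t = 3p/5, c is 1/25 for y = 0 and 1/25 - 9/25 for y =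
    t.\<close>
  have l: "1 / 25 \<in> Zloc" "- 8 / 25 \<in> Zloc" by simp_all
  have "cong_mod 5 (\<Sum>k\<le>n. w k * \<psi> t k * \<psi> 0 k) (of_nat p ^ 4 * (- 6 / 25 * (1 / 25) * (unit_residue * V0)))"
    by (rule special_sum_cong) (simp_all add: l t_def field_simps power2_eq_square)
  moreover have "cong_mod 5 (\<Sum>k\<le>n. w k * \<psi> t k * \<psi> t k) (of_nat p ^ 4 * (- 6 / 25 * (- 8 / 25) * (unit_residue * V0)))"
    by (rule special_sum_cong) (simp_all add: l t_def field_simps power2_eq_square)
  ultimately have "cong_mod 5 (2 * (\<Sum>k\<le>n. w k * \<psi> t k * \<psi> 0 k) - (\<Sum>k\<le>n. w k * \<psi> t k * \<psi> t k))
    (2 * (of_nat p ^ 4 * (- 6 / 25 * (1 / 25) * (unit_residue * V0))) - of_nat p ^ 4 * (- 6 / 25 * (- 8 / 25) * (unit_residue * V0)))"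
    by (intro cong_diff cong_scale) simp_all
  from cong_trans[OF truncated_sum_cong this] show ?thesis by (simp add: field_simps)
qed

section \<open>Reduction to factorials by Wilson's theorem\<close>

definition gamma_quotient :: rat where
  "gamma_quotient = fact (2 * j1) ^ 4 / (fact (4 * j1 + 1) ^ 2 * fact (n + j1) ^ 3 * fact (3 * j1 + 1))"

lemma four_j1_less: "4 * j1 + 1 < p" and three_j1: "3 * j1 + 1 < p" and n_add_j1: "n + j1 < p"
  using j_facts two_n by linarith+

text \<open>Wilson's theorem pairs n with 2 j1, n - 1 - 2 j1 with 4 j1 + 1, n - 1 - j1 with 3 j1 +
  1, and j1 with n + j1: each pair adds up to p - 1. The sign (-1)^j1 arises twice and
  cancels.\<close>

lemma unit_residue_cong: "cong_mod 1 unit_residue gamma_quotient" "unit_residue \<in> Zloc"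
proof -
  define X where "X = (\<Prod>j\<in>{..<n} - {j0}. of_nat (n + 1) + of_nat j :: rat)"
  define Y where "Y = (\<Prod>j\<in>{..<n} - {j1}. of_nat (n + j1 + 1) + of_nat j :: rat)"
  define s :: rat where "s = (-1) ^ j1"
  have ss: "s * s = 1" by (simp add: s_def flip: power_add)
  have fu: "fact i \<in> Zunits" if "i \<le> p - 1" for i
    using that p_gt by (intro Zunit_fact) linarith
  have wilson: "cong_mod 1 (fact (p - 1)) (- 1)" using cong_fact_mult[of 0 "p - 1"] by simp
  have loc: "X \<in> Zloc" "Y \<in> Zloc" "s \<in> Zloc" unfolding X_def Y_def s_def by (intro Zloc_prod Zloc_power; simp)+
  have c1: "cong_mod 1 (fact n * fact (2 * j1)) (- 1)"
    using cong_fact_mult[of n "2 * j1"] j_facts(2) even_n by simp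
  have c2: "cong_mod 1 (fact (n - 1 - 2 * j1) * fact (4 * j1 + 1)) 1"
  proof -
    have "even (Suc (n - 1 - 2 * j1))" using even_n j_facts(5) by simp
    then have "(-1 :: rat) ^ Suc (n - 1 - 2 * j1) = 1" by (rule neg_one_even_power)
    moreover have "n - 1 - 2 * j1 + (4 * j1 + 1) = p - 1" using j_facts by linarith
    note cong_fact_mult[OF this]
    ultimately show ?thesis by (simp only:)
  qed
  have c3: "cong_mod 1 (fact (3 * j1 + 1) * fact (n - 1 - j1)) s"
  proof -
    have "3 * j1 + 1 + (n - 1 - j1) = p - 1" using j_facts by linarith
    moreover have "(-1) ^ Suc (3 * j1 + 1) = s" by (simp add: s_def uminus_power_if)
    ultimately show ?thesis using cong_fact_mult[of "3 * j1 + 1" "n - 1 - j1"] by simp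
  qed
  have c4: "cong_mod 1 (fact j1 * fact (n + j1)) (- s)"
    using cong_fact_mult[of j1 "n + j1"] j_facts(2) by (simp add: s_def)
  have x: "cong_mod 1 (X * fact n) (fact (p - 1) * fact (n - 1 - 2 * j1))"
  proof -
    have "j0 + 1 + (n - 1 - 2 * j1) = n" using j_facts by linarith
    then show ?thesis
      using cong_skip_product[of "n + 1" j0 "n - 1 - 2 * j1"] j_facts unfolding X_def by simp
  qed
  have y: "cong_mod 1 (Y * fact (n + j1)) (fact (p - 1) * fact (n - 1 - j1))"
  proof -
    have "j1 + 1 + (n - 1 - j1) = n" using j_facts by linarith
    then show ?thesis
      using cong_skip_product[of "n + j1 + 1" j1 "n - 1 - j1"] j_facts unfolding Y_def by simp
  qed
  have z: "pochhammer (of_nat (j1 + 1)) n = (fact (n + j1) / fact j1 :: rat)"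
  proof -
    have "fact (j1 + n) = (pochhammer 1 j1 * pochhammer (1 + of_nat j1) n :: rat)"
      by (simp only: pochhammer_fact pochhammer_product')
    then show ?thesis by (simp add: pochhammer_fact[symmetric] add.commute field_simps)
  qed
  have p0: "pochhammer (- of_nat n) n = (fact n :: rat)"
    using pochhammer_neg_binomial[of n] even_n by (simp add: field_simps)
  \<comment> \<open>Grouped so that each bracket is congruent to a sign by Wilson's theorem.\<close>
  have eq: "unit_residue = (X * fact n * fact (4 * j1 + 1)) ^ 2 * (Y * fact (n + j1) * fact (3 * j1 + 1)) * (fact j1 * fact (n + j1))
    / ((fact n * fact (2 * j1)) ^ 4) * gamma_quotient"
    unfolding unit_residue_def gamma_quotient_def z p0 X_def[symmetric] Y_def[symmetric]
    by (simp add: divide_simps) (simp add: algebra_simps eval_nat_numeral)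
  have gq: "gamma_quotient \<in> Zloc"
    unfolding gamma_quotient_def using j_facts four_j1_less three_j1 n_add_j1
    by (intro Zloc_divide Zunit_mult Zunit_power Zunit_fact) simp_all
  have un: "fact n * fact (2 * j1) \<in> Zunits"
    using j_facts by (intro Zunit_mult fu) linarith+
  have X2: "cong_mod 1 (X * fact n * fact (4 * j1 + 1)) (- 1)"
  proof -
    have "cong_mod 1 (X * fact n * fact (4 * j1 + 1)) (fact (p - 1) * fact (n - 1 - 2 * j1) * fact (4 * j1 + 1))"
      using x by (rule cong_mult) (simp_all add: loc)
    also have "fact (p - 1) * fact (n - 1 - 2 * j1) * fact (4 * j1 + 1) = (fact (p - 1) * (fact (n - 1 - 2 * j1) * fact (4 * j1 + 1)) :: rat)"
      by (simp only: mult.assoc)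
    also have "cong_mod 1 \<dots> (- 1 * 1)"
      using wilson c2 by (rule cong_mult) simp_all
    finally show ?thesis by simp
  qed
  have Y2: "cong_mod 1 (Y * fact (n + j1) * fact (3 * j1 + 1)) (- s)"
  proof -
    have "cong_mod 1 (Y * fact (n + j1) * fact (3 * j1 + 1)) (fact (p - 1) * fact (n - 1 - j1) * fact (3 * j1 + 1))"
      using y by (rule cong_mult) (simp_all add: loc)
    also have "fact (p - 1) * fact (n - 1 - j1) * fact (3 * j1 + 1) = (fact (p - 1) * (fact (3 * j1 + 1) * fact (n - 1 - j1)) :: rat)"
      by (simp only: mult_ac)
    also have "cong_mod 1 \<dots> (- 1 * s)"
      using wilson c3 by (rule cong_mult) (simp_all add: loc)
    finally show ?thesis by simp
  qed
  have m1: "- 1 \<in> Zunits" using Zunit_of_int[of "- 1"] not_dvd_one by simp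
  have "cong_mod 1 unit_residue ((- 1) ^ 2 * (- s) * (- s) / ((- 1) ^ 4) * gamma_quotient)"
    unfolding eq using un loc gq m1
    by (intro cong_mult cong_divide cong_power X2 Y2 c1 c4 cong_refl Zloc_divide Zloc_mult Zloc_power Zunit_power) simp_all
  also have "(- 1) ^ 2 * (- s) * (- s) / ((- 1) ^ 4) * gamma_quotient = gamma_quotient"
    using ss by simp
  finally show "cong_mod 1 unit_residue gamma_quotient" .
  show "unit_residue \<in> Zloc"
    unfolding eq using un loc gq by (intro Zloc_mult Zloc_divide Zloc_power Zunit_power) simp_all
qed

text \<open>As 10k + r = 5 (a + 2k), the coefficient -12/125 becomes -12/25. The minus sign stays
  with \<open>gamma_quotient\<close>, because the Gamma quotient corresponds to its
  negative.\<close>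

theorem rational_congruence:
  "cong_mod 5 (\<Sum>k<p. (10 * of_nat k + of_int r) * (pochhammer a k ^ 5 / fact k ^ 5))
    (12 * of_nat p ^ 4 / 25 * (- gamma_quotient) * V0)"
proof -
  have "cong_mod 1 (- 12 / 25 * (unit_residue * V0)) (- 12 / 25 * (gamma_quotient * V0))"
    using unit_residue_cong V0_Zloc by (intro cong_scale cong_mult cong_refl) simp_all
  from cong_power_scale[OF this, of 4]
  have "cong_mod 5 (of_nat p ^ 4 * (- 12 / 25 * (unit_residue * V0))) (of_nat p ^ 4 * (- 12 / 25 * (gamma_quotient * V0)))"
    by simp
  moreover have "of_nat p ^ 4 * (- 12 / 25 * (unit_residue * V0)) = 5 * (- 12 / 125 * of_nat p ^ 4 * unit_residue * V0)"
    by simp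
  moreover have "of_nat p ^ 4 * (- 12 / 25 * (gamma_quotient * V0)) = 12 * of_nat p ^ 4 / 25 * (- gamma_quotient) * V0"
    by simp
  moreover have "cong_mod 5 (5 * (\<Sum>k<p. (a + 2 * of_nat k) * (pochhammer a k ^ 5 / fact k ^ 5)))
      (5 * (- 12 / 125 * of_nat p ^ 4 * unit_residue * V0))"
    by (rule cong_scale[OF truncated_sum_main]) simp
  moreover have "5 * (\<Sum>k<p. (a + 2 * of_nat k) * (pochhammer a k ^ 5 / fact k ^ 5))
      = (\<Sum>k<p. (10 * of_nat k + of_int r) * (pochhammer a k ^ 5 / fact k ^ 5))"
    unfolding sum_distrib_left by (intro sum.cong refl) (simp add: a_def distrib_left mult.assoc[symmetric])
  ultimately show ?thesis using cong_trans by (simp only:)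
qed

end

section \<open>Gamma values as factorials and transfer to the p-adic integers\<close>

definition gamma_rat :: "nat \<Rightarrow> rat" where
  "gamma_rat m = (-1) ^ m * fact (m - 1)"

lemma padic_dvd_quotient_diff:
  fixes x x' y y' d :: "'p::prime_card padic_int"
  assumes "d dvd x - x'" "d dvd y - y'" "y dvd 1" "y' dvd 1"
  shows "d dvd x / y - x' / y'"
proof -
  have "(x / y - x' / y') * (y * y') = (x / y * y) * y' - (x' / y' * y') * y"
    by (simp add: algebra_simps)
  also have "\<dots> = (x - x') * y' - x' * (y - y')"
    unfolding padic_divide_mult_cancel[OF assms(3)] padic_divide_mult_cancel[OF assms(4)] by (simp add: algebra_simps)
  finally have "d dvd (x / y - x' / y') * (y * y')"
    using assms(1,2) by simp
  moreover have "y * y' dvd 1" using assms(3,4) by (metis mult_dvd_mono mult_1)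
  then obtain z where "1 = y * y' * z" by (rule dvdE)
  ultimately show ?thesis by (metis dvd_mult2 mult.assoc mult.right_neutral)
qed

lemma dvd_mult_diff:
  fixes d :: "'a::comm_ring_1"
  assumes "d dvd x - x'" "d dvd y - y'"
  shows "d dvd x * y - x' * y'"
proof -
  have "x * y - x' * y' = (x - x') * y + x' * (y - y')" by (simp add: algebra_simps)
  then show ?thesis using assms by simp
qed

lemma dvd_power_diff:
  fixes d :: "'a::comm_ring_1"
  assumes "d dvd x - x'"
  shows "d dvd x ^ k - x' ^ k"
  using assms by (induction k) (simp_all add: dvd_mult_diff)

lemma padic_unit_cong:
  fixes x y :: "'p::prime_card padic_int"
  assumes "of_nat CARD('p) dvd x - y" "y dvd 1"
  shows "x dvd 1"
proof (rule padic_unitI, rule notI)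
  assume "padic_residue x 1 = 0"
  then have "of_nat CARD('p) dvd x" by (rule padic_dvd_prime)
  with assms(1) have "of_nat CARD('p) dvd y" by (metis dvd_diff diff_diff_eq2 add_diff_cancel_left' dvd_minus_iff minus_diff_eq)
  then have "of_nat CARD('p) dvd (1 :: 'p padic_int)" using assms(2) by (rule dvd_trans)
  then obtain z :: "'p padic_int" where "1 = of_nat CARD('p) * z" by (rule dvdE)
  then have "padic_residue (1 :: 'p padic_int) 1 = padic_residue (of_nat CARD('p) * z) 1" by (rule arg_cong)
  then show False
    using card_prime_gt_1[where 'p='p]
    by (simp add: one_padic_int.rep_eq times_padic_int.rep_eq padic_residue_of_nat)
qed

context
  fixes P :: "'p::prime_card itself"
begin

interpretation rat_localization "CARD('p)"
  by unfold_locales (rule prime_card)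

lemma padic_of_rat_residue_cong:
  assumes "cong_mod 1 x y" "x \<in> Zloc" "y \<in> Zloc"
  shows "padic_residue (padic_of_rat x :: 'p padic_int) 1 = padic_residue (padic_of_rat y :: 'p padic_int) 1"
proof -
  obtain z where z: "z \<in> Zloc" "x - y = of_nat CARD('p) * z" using assms(1) by (auto simp: cong_mod_def)
  have "x = y + of_nat CARD('p) * z" using z(2) by simp
  then have "(padic_of_rat x :: 'p padic_int) = padic_of_rat y + of_nat CARD('p) * padic_of_rat z"
    using assms z(1) by (simp add: padic_of_rat_add padic_of_rat_mult padic_of_rat_numeral)
  moreover have "padic_residue (of_nat CARD('p) * padic_of_rat z :: 'p padic_int) 1 = 0"
    by (simp add: times_padic_int.rep_eq padic_residue_of_nat)
  ultimately show ?thesis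
    using padic_residue_mod[of "padic_of_rat y :: 'p padic_int" 1] by (simp add: plus_padic_int.rep_eq)
qed

text \<open>Modulo p the argument may be replaced by a natural m \<le> p, and for such m the Gamma
  product skips no factor, which leaves a signed factorial.\<close>

lemma padic_Gamma_cong:
  assumes "odd CARD('p)" "cong_mod 1 x (of_nat m)" "x \<in> Zloc" "0 < m" "m \<le> CARD('p)"
  shows "of_nat CARD('p) dvd padic_Gamma (padic_of_rat x :: 'p padic_int) - padic_of_rat (gamma_rat m)"
proof (rule padic_dvd_prime)
  have "padic_residue (of_nat m :: 'p padic_int) 1 = padic_residue (padic_of_rat x :: 'p padic_int) 1"
    using padic_of_rat_residue_cong[OF assms(2,3)] by (simp add: padic_of_rat_numeral)
  then have "padic_residue (padic_Gamma (padic_of_rat x :: 'p padic_int)) 1 = padic_residue (padic_Gamma_nat m :: 'p padic_int) 1"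
    by (rule padic_Gamma_residue[OF assms(1)])
  moreover have "(padic_Gamma_nat m :: 'p padic_int) = padic_of_rat (gamma_rat m)"
  proof -
    have "(padic_Gamma_nat m :: 'p padic_int) = padic_of_rat (of_int ((-1) ^ m * fact (m - 1)))"
      unfolding padic_Gamma_nat_eq padic_of_rat_of_int
      using gamma_int_fact[OF prime_p assms(1,4,5)] by (rule arg_cong)
    then show ?thesis by (simp add: gamma_rat_def)
  qed
  ultimately show "padic_residue (padic_Gamma (padic_of_rat x :: 'p padic_int) - padic_of_rat (gamma_rat m)) 1 = 0"
    by (simp add: minus_padic_int.rep_eq)
qed

end

context truncated_sum
begin

text \<open>Replacing a by -n and adding p, 2p, 3p/2 and p/2, respectively, yields natural numbers;
  by \<open>four_j1_less\<close>, \<open>three_j1\<close> and \<open>n_add_j1\<close> these are at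
  most p.\<close>

lemma gamma_arguments:
  "cong_mod 1 a (of_nat (2 * j1 + 1))" "cong_mod 1 (2 * a) (of_nat (4 * j1 + 2))"
  "cong_mod 1 (1 / 2 + 3 * of_int r / 10) (of_nat (3 * j1 + 2))" "cong_mod 1 (1 / 2 - of_int r / 10) (of_nat (n + j1 + 1))"
proof -
  have shift: "cong_mod 1 x (y + of_nat p * c)" if "cong_mod 1 x y" "c \<in> Zloc" for x y c
  proof -
    have "cong_mod 1 (y + 0) (y + of_nat p * c)"
      by (intro cong_add cong_refl cong_sym[OF cong_prime_multiple[OF that(2)]])
    then show ?thesis using cong_trans[OF that(1)] by simp
  qed
  show "cong_mod 1 a (of_nat (2 * j1 + 1))"
    using shift[OF a_cong, of 1] by (simp add: p_rat add.commute)
  show "cong_mod 1 (2 * a) (of_nat (4 * j1 + 2))"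
    using shift[OF cong_scale[OF a_cong, of 2], of 2] by (simp add: p_rat add.commute)
  have "cong_mod 1 ((1 + 3 * a) / 2) ((1 + 3 * - of_nat n) / 2)"
    by (intro cong_divide cong_add cong_scale cong_refl a_cong) simp_all
  from shift[OF this, of "3 / 2"] show "cong_mod 1 (1 / 2 + 3 * of_int r / 10) (of_nat (3 * j1 + 2))"
    by (simp add: p_rat a_def add_divide_distrib diff_divide_distrib distrib_left add.commute)
  have "cong_mod 1 ((1 - a) / 2) ((1 - - of_nat n) / 2)"
    by (intro cong_divide cong_diff cong_refl a_cong) simp_all
  from shift[OF this, of "1 / 2"] show "cong_mod 1 (1 / 2 - of_int r / 10) (of_nat (n + j1 + 1))"
    by (simp add: p_rat a_def add_divide_distrib diff_divide_distrib distrib_left add.commute)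
qed

text \<open>With s = (-1)^j1 the Gamma values carry the signs -1, 1, s and -s. The fourth power and
  the square are positive, and s (-s)^3 = -1 gives the minus sign.\<close>

lemma gamma_quotient_eq:
  "- gamma_quotient = gamma_rat (2 * j1 + 1) ^ 4 /
    (gamma_rat (4 * j1 + 2) ^ 2 * gamma_rat (3 * j1 + 2) * gamma_rat (n + j1 + 1) ^ 3)"
proof -
  define s :: rat where "s = (-1) ^ j1"
  have s: "s * s = 1" "s \<noteq> 0" by (simp_all add: s_def flip: power_add)
  have "gamma_rat (2 * j1 + 1) = - fact (2 * j1)" "gamma_rat (4 * j1 + 2) = 1 * fact (4 * j1 + 1)"
    "gamma_rat (3 * j1 + 2) = s * fact (3 * j1 + 1)" "gamma_rat (n + j1 + 1) = - s * fact (n + j1)"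
    using even_n by (simp_all add: gamma_rat_def s_def uminus_power_if)
  moreover have "(- x :: rat) ^ 4 / ((1 * y) ^ 2 * (s * z) * (- s * v) ^ 3) = - (x ^ 4 / (y ^ 2 * v ^ 3 * z))" for x y z v
  proof -
    have "(1 * y) ^ 2 * (s * z) * (- s * v) ^ 3 = - ((s * s) * (s * s) * (y ^ 2 * v ^ 3 * z))"
      by (simp add: power2_eq_square power3_eq_cube mult_ac)
    then show ?thesis using s(1) by simp
  qed
  ultimately show ?thesis by (simp only: gamma_quotient_def)
qed

lemma V0_eq: "V0 = (\<Sum>k = 0..N. (pochhammer ((of_int r - 1) / 2) k * pochhammer (of_int r / 5) k ^ 3) /
          (pochhammer 1 k * pochhammer (2 * of_int r / 5) k ^ 2 * pochhammer (1 / 2 + 3 * of_int r / 10) k))"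
proof -
  have "- of_nat N = (of_int r - 1) / (2 :: rat)" using N_eq by (simp add: a_def field_simps)
  moreover have "2 * a = 2 * of_int r / 5" "(1 + 3 * a) / 2 = 1 / 2 + 3 * of_int r / 10"
    by (simp_all add: a_def add_divide_distrib)
  ultimately show ?thesis
    unfolding V0_def by (simp only: a_def[symmetric] pochhammer_fact atMost_atLeast0)
qed

end

theorem theorem1p2:
  fixes r :: int and p :: nat
  assumes "p = CARD('p::prime_card)"
    and "r \<le> 1" and "odd r" and "coprime r 5"
    and "prime p" and "odd p"
    and "[int p = 2 * r] (mod 5)"
    and "real p \<ge> (5 - real_of_int r) / 2"
  shows "(of_nat p ^ 5 :: 'p padic_int) dvd
    (\<Sum>k = 0..p - 1. (10 * of_nat k + of_int r) *
        (pochhammer (of_int r / 5) k ^ 5 / pochhammer 1 k ^ 5))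
    - 12 * of_nat p ^ 4 / 25 *
        (padic_Gamma (of_int r / 5) ^ 4 /
          (padic_Gamma (2 * of_int r / 5) ^ 2 * padic_Gamma (1 / 2 + 3 * of_int r / 10) *
            padic_Gamma (1 / 2 - of_int r / 10) ^ 3)) *
        (\<Sum>k = 0..nat ((1 - r) div 2).
          (pochhammer ((of_int r - 1) / 2) k * pochhammer (of_int r / 5) k ^ 3) /
          (pochhammer 1 k * pochhammer (2 * of_int r / 5) k ^ 2 *
            pochhammer (1 / 2 + 3 * of_int r / 10) k))"
proof -
  define n where n_nat: "n = nat ((3 * int p - r) div 5)"
  define N where N_nat: "N = nat ((1 - r) div 2)"
  have five: "5 dvd 3 * int p - r"
  proof -
    have "5 dvd int p - 2 * r" using assms(7) by (simp add: cong_iff_dvd_diff)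
    \<comment> \<open>The multiplier 3 is the inverse of 2 modulo 5.\<close>
    then have "5 dvd 3 * (int p - 2 * r) + 5 * r" by (intro dvd_add dvd_mult dvd_triv_left)
    moreover have "3 * (int p - 2 * r) + 5 * r = 3 * int p - r" by simp
    ultimately show ?thesis by (simp only:)
  qed
  have n: "5 * int n = 3 * int p - r" using five assms(2) prime_gt_0_nat[OF assms(5)] pos_imp_zdiv_nonneg_iff[of 5 "3 * int p - r"] by (simp add: n_nat)
  have N: "2 * int N = 1 - r" using assms(2,3) by (simp add: N_nat)
  have r5: "\<not> 5 dvd r"
    using assms(4) by (metis coprime_common_divisor dvd_refl zdvd1_eq abs_numeral numeral_eq_one_iff num.distinct(3))
  interpret truncated_sum p r n N
  proof
    show "prime p" "odd p" "r \<le> 1" "\<not> 5 dvd r" "5 * int n = 3 * int p - r" "2 * int N = 1 - r"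
      by fact+
    have "even (5 * int n)" unfolding n using assms(3,6) by simp
    then show "even n" by simp
    have "real_of_int (5 - r) \<le> real_of_int (2 * int p)" using assms(8) by simp
    then show "5 - r \<le> 2 * int p" by (simp only: of_int_le_iff)
  qed
  note p = assms(1)
  let ?E = "padic_of_rat :: rat \<Rightarrow> 'p padic_int"
  note hom = padic_of_rat_numeral[where 'p='p] padic_of_rat_of_int[where 'p='p]
    padic_of_rat_add[where 'p='p, folded p] padic_of_rat_mult[where 'p='p, folded p]
    padic_of_rat_diff[where 'p='p, folded p] padic_of_rat_uminus[where 'p='p, folded p]
    padic_of_rat_quotient[where 'p='p, folded p] padic_of_rat_power[where 'p='p, folded p]
    padic_of_rat_sum[where 'p='p, folded p] padic_of_rat_pochhammer[where 'p='p, folded p]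
  have Zunit_10 [simp]: "10 \<in> Zunits" using Zunit_mult[OF Zunit_2 Zunit_5] by simp
  have args: "?E (of_int r / 5) = of_int r / 5" "?E (2 * of_int r / 5) = 2 * of_int r / 5"
    "?E (1 / 2 + 3 * of_int r / 10) = 1 / 2 + 3 * of_int r / 10" "?E (1 / 2 - of_int r / 10) = 1 / 2 - of_int r / 10"
    "?E ((of_int r - 1) / 2) = (of_int r - 1) / 2"
    by (simp_all add: hom)
  have loc: "of_int r / 5 \<in> Zloc" "2 * of_int r / 5 \<in> Zloc" "1 / 2 + 3 * of_int r / 10 \<in> Zloc"
    "1 / 2 - of_int r / 10 \<in> Zloc" "(of_int r - 1) / 2 \<in> Zloc"
    by simp_all
  define L where "L = (\<Sum>k<p. (10 * of_nat k + of_int r) * (pochhammer a k ^ 5 / fact k ^ 5))"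
  have set: "{0..p - 1} = {..<p}" using p_gt by auto
  have fu: "pochhammer 1 k \<in> Zunits" if "k < p" for k
    using Zunit_fact[OF that] by (simp add: pochhammer_fact)
  have L: "?E L = (\<Sum>k = 0..p - 1. (10 * of_nat k + of_int r) * (pochhammer (of_int r / 5) k ^ 5 / pochhammer 1 k ^ 5))"
  proof -
    let ?u = "\<lambda>k. 10 * of_nat k + of_int r" and ?v = "\<lambda>k. pochhammer (of_int r / 5) k ^ 5 / pochhammer 1 k ^ 5"
    have v: "?v k \<in> Zloc" if "k < p" for k
      using fu[OF that] by simp
    have "?E L = (\<Sum>k<p. ?E (?u k * ?v k))"
      unfolding L_def a_def pochhammer_fact
      using v by (intro padic_of_rat_sum[where 'p='p, folded p] Zloc_mult) simp_all
    also have "\<dots> = (\<Sum>k<p. ?E (?u k) * ?E (?v k))"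
      using v by (intro sum.cong refl padic_of_rat_mult[where 'p='p, folded p]) simp_all
    also have "\<dots> = (\<Sum>k<p. ?u k * ?v k)"
      using loc fu by (intro sum.cong refl) (simp add: hom args Zunit_Zloc)
    finally show ?thesis unfolding set .
  qed
  have V: "?E V0 = (\<Sum>k = 0..nat ((1 - r) div 2).
          (pochhammer ((of_int r - 1) / 2) k * pochhammer (of_int r / 5) k ^ 3) /
          (pochhammer 1 k * pochhammer (2 * of_int r / 5) k ^ 2 * pochhammer (1 / 2 + 3 * of_int r / 10) k))"
  proof -
    let ?num = "\<lambda>k. pochhammer ((of_int r - 1) / 2) k * pochhammer (of_int r / 5) k ^ 3"
    let ?den = "\<lambda>k. pochhammer 1 k * pochhammer (2 * of_int r / 5) k ^ 2 * pochhammer (1 / 2 + 3 * of_int r / 10) k"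
    have u: "pochhammer (2 * of_int r / 5) k \<in> Zunits" "pochhammer (1 / 2 + 3 * of_int r / 10) k \<in> Zunits"
      "pochhammer 1 k \<in> Zunits" if "k \<le> N" for k
      using two_a_unit[OF that] three_a_unit[OF that] fu[of k] N_less that by (simp_all add: a_def add_divide_distrib)
    have den: "?den k \<in> Zunits" if "k \<le> N" for k
      using u[OF that] by (intro Zunit_mult Zunit_power)
    have num: "?num k \<in> Zloc" for k
      using loc by (intro Zloc_mult Zloc_power Zloc_pochhammer)
    have "?E V0 = (\<Sum>k = 0..N. ?E (?num k / ?den k))"
      unfolding V0_eq using num den by (intro padic_of_rat_sum[where 'p='p, folded p] Zloc_divide) simp_all
    also have "\<dots> = (\<Sum>k = 0..N. ?E (?num k) / ?E (?den k))"
      using num den by (intro sum.cong refl padic_of_rat_quotient[where 'p='p, folded p]) simp_all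
    also have "\<dots> = (\<Sum>k = 0..N. ?num k / ?den k)"
      using loc u by (intro sum.cong refl) (simp add: hom(5-) args Zunit_Zloc padic_of_rat_numeral[where 'p='p])
    finally show ?thesis unfolding N_nat .
  qed
  let ?\<Gamma> = "\<lambda>x. padic_Gamma (?E x)"
  \<comment> \<open>Being congruent to units, the true Gamma values are units as well, so their
    quotient is a genuine one and not the junk value.\<close>
  have \<Gamma>: "of_nat p dvd ?\<Gamma> x - ?E (gamma_rat m)" "?E (gamma_rat m) dvd 1" "?\<Gamma> x dvd 1" "gamma_rat m \<in> Zunits"
    if "cong_mod 1 x (of_nat m)" "x \<in> Zloc" "0 < m" "m \<le> p" for x m
  proof -
    show 1: "of_nat p dvd ?\<Gamma> x - ?E (gamma_rat m)"
      using padic_Gamma_cong[where 'p='p, folded p, OF assms(6) that] .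
    have "(-1) ^ m \<in> Zunits" using Zunit_of_int[of "- 1"] not_dvd_one by (intro Zunit_power) simp
    moreover have "fact (m - 1) \<in> Zunits" using that by (intro Zunit_fact) linarith
    ultimately show u: "gamma_rat m \<in> Zunits" unfolding gamma_rat_def by (rule Zunit_mult)
    then show 2: "?E (gamma_rat m) dvd 1" by (rule padic_of_rat_unit[where 'p='p, folded p])
    show "?\<Gamma> x dvd 1" using padic_unit_cong[where 'p='p, folded p, OF 1 2] .
  qed
  have "2 * j1 + 1 \<le> p" "4 * j1 + 2 \<le> p" "3 * j1 + 2 \<le> p" "n + j1 + 1 \<le> p"
    using four_j1_less three_j1 n_add_j1 j_facts(2) by linarith+
  note \<Gamma>1 = \<Gamma>[OF gamma_arguments(1)[unfolded a_def] loc(1) _ this(1)]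
    and \<Gamma>2 = \<Gamma>[OF gamma_arguments(2)[unfolded a_def times_divide_eq_right] loc(2) _ this(2)]
    and \<Gamma>3 = \<Gamma>[OF gamma_arguments(3) loc(3) _ this(3)]
    and \<Gamma>4 = \<Gamma>[OF gamma_arguments(4) loc(4) _ this(4)]
  define G where "G = padic_Gamma (of_int r / 5 :: 'p padic_int) ^ 4 /
          (padic_Gamma (2 * of_int r / 5) ^ 2 * padic_Gamma (1 / 2 + 3 * of_int r / 10) *
            padic_Gamma (1 / 2 - of_int r / 10) ^ 3)"
  have unit_mult: "x * y dvd 1" if "x dvd 1" "y dvd 1" for x y :: "'p padic_int"
    using mult_dvd_mono[OF that] by simp
  have unit_power: "x ^ k dvd 1" if "x dvd 1" for x :: "'p padic_int" and k
    using that by (induction k) (simp_all add: unit_mult)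
  have gq_units: "gamma_rat (4 * j1 + 2) ^ 2 * gamma_rat (3 * j1 + 2) * gamma_rat (n + j1 + 1) ^ 3 \<in> Zunits"
    "gamma_rat (2 * j1 + 1) ^ 4 \<in> Zunits"
    using \<Gamma>1(4) \<Gamma>2(4) \<Gamma>3(4) \<Gamma>4(4) by simp_all
  have G: "of_nat p dvd G - ?E (- gamma_quotient)"
  proof -
    have "?E (- gamma_quotient) = ?E (gamma_rat (2 * j1 + 1)) ^ 4 /
      (?E (gamma_rat (4 * j1 + 2)) ^ 2 * ?E (gamma_rat (3 * j1 + 2)) * ?E (gamma_rat (n + j1 + 1)) ^ 3)"
      unfolding gamma_quotient_eq using gq_units \<Gamma>1(4) \<Gamma>2(4) \<Gamma>3(4) \<Gamma>4(4)
      by (simp add: hom(5-) Zunit_Zloc)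
    moreover have "G = ?\<Gamma> (of_int r / 5) ^ 4 /
      (?\<Gamma> (2 * of_int r / 5) ^ 2 * ?\<Gamma> (1 / 2 + 3 * of_int r / 10) * ?\<Gamma> (1 / 2 - of_int r / 10) ^ 3)"
      unfolding G_def args ..
    moreover have "of_nat p dvd \<dots> - ?E (gamma_rat (2 * j1 + 1)) ^ 4 /
      (?E (gamma_rat (4 * j1 + 2)) ^ 2 * ?E (gamma_rat (3 * j1 + 2)) * ?E (gamma_rat (n + j1 + 1)) ^ 3)"
      by (intro padic_dvd_quotient_diff dvd_mult_diff dvd_power_diff unit_mult unit_power
          \<Gamma>1(1-3) \<Gamma>2(1-3) \<Gamma>3(1-3) \<Gamma>4(1-3)) simp_all
    ultimately show ?thesis by (simp only:)
  qed
  have gq: "- gamma_quotient \<in> Zloc"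
    unfolding gamma_quotient_eq using gq_units by (intro Zloc_divide) (simp_all add: Zunit_Zloc)
  have Lloc: "L \<in> Zloc"
    unfolding L_def using Zunit_fact by (intro Zloc_sum Zloc_mult Zloc_divide Zunit_power) simp_all
  let ?R = "12 * of_nat p ^ 4 / 25 * (- gamma_quotient) * V0"
  have "cong_mod 5 (L - ?R) 0"
    using rational_congruence unfolding L_def cong_mod_def by simp
  then have "of_nat p ^ 5 dvd ?E (L - ?R)" by (rule padic_of_rat_dvd[where 'p='p, folded p])
  moreover have "?E (L - ?R) = ?E L - 12 * of_nat p ^ 4 / 25 * ?E (- gamma_quotient) * ?E V0"
    using Lloc gq V0_Zloc by (simp add: hom del: mult_minus_right mult_minus_left times_divide_eq_right times_divide_eq_left)
  \<comment> \<open>The Gamma quotient is known only modulo p; the factor p^4 in front of it raises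
    this to p^5.\<close>
  moreover have "of_nat p ^ 5 dvd 12 * of_nat p ^ 4 / 25 * (G - ?E (- gamma_quotient)) * ?E V0"
  proof -
    have p5: "of_nat p ^ 4 * of_nat p = (of_nat p ^ 5 :: 'p padic_int)"
      by (simp add: eval_nat_numeral mult_ac)
    have "of_nat p ^ 4 * of_nat p dvd (of_nat p ^ 4 * (G - ?E (- gamma_quotient)))"
      using G by (intro mult_dvd_mono) simp_all
    then have "of_nat p ^ 5 dvd of_nat p ^ 4 * (G - ?E (- gamma_quotient)) * (12 * inverse 25 * ?E V0)"
      unfolding p5 by (rule dvd_mult2)
    then show ?thesis by (simp add: divide_padic_int_def mult_ac)
  qed
  ultimately have "of_nat p ^ 5 dvd ?E L - 12 * of_nat p ^ 4 / 25 * ?E (- gamma_quotient) * ?E V0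
      - 12 * of_nat p ^ 4 / 25 * (G - ?E (- gamma_quotient)) * ?E V0"
    by (metis dvd_diff)
  then have "of_nat p ^ 5 dvd ?E L - 12 * of_nat p ^ 4 / 25 * G * ?E V0"
    by (simp add: algebra_simps)
  then show ?thesis unfolding L V G_def .
qed

end
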